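(* Let $n\ge 2$, $1\le k\le n-1$, $\alpha_1,\alpha_2\in\mathbb{R}$ and $1\le p<\infty$. Suppose that either (i) $\alpha_1+\alpha_2>k-n$ and $1\le p<\frac{\alpha_1+\alpha_2+n-1}{k-1}$ (the right-hand side is read as $+\infty$ when $k=1$), or (ii) $\alpha_1+\alpha_2=k-n$ and $p=1$. Then for every $f\in L^p_{\alpha_1,\alpha_2}(\mathbb{H}^n)$ the integral defining $R_kf(\xi)$ converges absolutely for almost every $\xi\in\Xi_k(\mathbb{H}^n)$. Conversely, if neither (i) nor (ii) holds, then there exists a nonnegative radial function $f\in L^p_{\alpha_1,\alpha_2}(\mathbb{H}^n)$ such that $R_kf(\xi)=+\infty$ for every $\xi\in\Xi_k(\mathbb{H}^n)$.
   Context: $\mathbb{H}^n$ is the real hyperbolic space of constant curvature $-1$ (Poincaré ball model) with origin $0$, geodesic distance $d$ and Riemannian volume $dx$. $\Xi_k(\mathbb{H}^n)$ is the set of $k$-dimensional totally geodesic submanifolds of $\mathbb{H}^n$, with $d(0,\xi)=\inf_{x\in\xi}d(0,x)$; it carries the isometry-invariant measure $d\xi$ given by $\int_{\Xi_k}\varphi\,d\xi=c_{n,k}\int_{SO(n)}\int_0^\infty\varphi(\xi(g,h))\cosh^k h\,\sinh^{n-k-1}h\,dh\,dg$, where $dg$ is Haar probability measure, $\mathbb{R}^k=\mathrm{span}\{e_1,\dots,e_k\}$, and $\xi(g,h)$ is the image of the totally geodesic submanifold $g(\mathbb{R}^k)\cap\mathbb{H}^n$ under the hyperbolic translation by distance $h$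 along the geodesic through $0$ in direction $ge_{k+1}$. The $k$-plane transform is $R_kf(\xi)=\int_\xi f(x)\,d_\xi x$, with $d_\xi x$ the induced Riemannian measure on $\xi$. $L^p_{\alpha_1,\alpha_2}(\mathbb{H}^n)$ is the space of measurable $f$ with $\|f\|^p=\int_{\mathbb{H}^n}|f(x)|^p\sinh^{\alpha_1}d(0,x)\cosh^{\alpha_2}d(0,x)\,dx<\infty$. A function on $\mathbb{H}^n$ is radial if it depends only on $d(0,x)$. *)

theory Defs
  imports "HOL-Analysis.Analysis"
begin

text \<open>The Poincare ball is the open unit ball of real^'n, with metric
  4|dx|^2/(1-|x|^2)^2 (curvature -1).\<close>

definition hdist0 :: "real^'n \<Rightarrow> real" where
  "hdist0 x = ln ((1 + norm x) / (1 - norm x))"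

definition hvol :: "(real^'n) measure" where
  "hvol = density lborel
     (\<lambda>x. ennreal (indicator (ball 0 1) x * (2 / (1 - (norm x)\<^sup>2)) ^ CARD('n)))"

text \<open>Weighted space; L^p classes are represented by Borel measurable functions.\<close>
definition weighted_Lp :: "real \<Rightarrow> real \<Rightarrow> real \<Rightarrow> (real^'n \<Rightarrow> real) set" where
  "weighted_Lp p a1 a2 = {f. f \<in> borel_measurable borel \<and>
     (\<integral>\<^sup>+ x. ennreal (\<bar>f x\<bar> powr p * sinh (hdist0 x) powr a1 * cosh (hdist0 x) powr a2) \<partial>hvol) < \<infinity>}"

definition radial :: "(real^'n \<Rightarrow> real) \<Rightarrow> bool" where
  "radial f \<longleftrightarrow> (\<exists>F. \<forall>x\<in>ball 0 1. f x = F (hdist0 x))"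

text \<open>Moebius addition: x \<mapsto> a (+) x is the hyperbolic translation along the geodesic
  through 0 and a, sending 0 to a.\<close>
definition mobius_add :: "real^'n \<Rightarrow> real^'n \<Rightarrow> real^'n" where
  "mobius_add a x = inverse (1 + 2 * (a \<bullet> x) + (norm a)\<^sup>2 * (norm x)\<^sup>2) *\<^sub>R
     ((1 + 2 * (a \<bullet> x) + (norm x)\<^sup>2) *\<^sub>R a + (1 - (norm a)\<^sup>2) *\<^sub>R x)"

text \<open>Hyperbolic translation by distance h along the geodesic through 0 in unit direction u.\<close>
definition htrans :: "real^'n \<Rightarrow> real \<Rightarrow> real^'n \<Rightarrow> real^'n" where
  "htrans u h = mobius_add (tanh (h / 2) *\<^sub>R u)"

definition SOn :: "(real^'n^'n) set" where
  "SOn = {g. orthogonal_matrix g \<and> det g = 1}"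

text \<open>Standard basis e_1, ..., e_n, via an enumeration \<iota> of the index type:
  e_(i+1) = ebasis \<iota> i.\<close>
definition ebasis :: "(nat \<Rightarrow> 'n) \<Rightarrow> nat \<Rightarrow> real^'n" where
  "ebasis \<iota> i = axis (\<iota> i) 1"

text \<open>Parametrisation of xi(g,h) by the Poincare ball B^k (coordinates t_0..t_(k-1)):
  t \<mapsto> translate (sum t_i g e_(i+1)). Since this is an isometry of H^k onto xi(g,h),
  the induced measure on xi(g,h) is the pushforward of the hyperbolic volume of B^k.\<close>
definition xi_pt :: "(nat \<Rightarrow> 'n) \<Rightarrow> nat \<Rightarrow> real^'n^'n \<Rightarrow> real \<Rightarrow> (nat \<Rightarrow> real) \<Rightarrow> real^'n" where
  "xi_pt \<iota> k g h t = htrans (g *v ebasis \<iota> k) h (\<Sum>i<k. t i *\<^sub>R (g *v ebasis \<iota> i))"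

definition hk_meas :: "nat \<Rightarrow> (nat \<Rightarrow> real) measure" where
  "hk_meas k = density (Pi\<^sub>M {..<k} (\<lambda>_. lborel))
     (\<lambda>t. ennreal (if (\<Sum>i<k. (t i)\<^sup>2) < 1 then (2 / (1 - (\<Sum>i<k. (t i)\<^sup>2))) ^ k else 0))"

definition Rk_abs :: "(nat \<Rightarrow> 'n) \<Rightarrow> nat \<Rightarrow> (real^'n \<Rightarrow> real) \<Rightarrow> real^'n^'n \<Rightarrow> real \<Rightarrow> ennreal" where
  "Rk_abs \<iota> k f g h = (\<integral>\<^sup>+ t. ennreal \<bar>f (xi_pt \<iota> k g h t)\<bar> \<partial>hk_meas k)"

definition Rk_nn :: "(nat \<Rightarrow> 'n) \<Rightarrow> nat \<Rightarrow> (real^'n \<Rightarrow> real) \<Rightarrow> real^'n^'n \<Rightarrow> real \<Rightarrow> ennreal" where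
  "Rk_nn \<iota> k f g h = (\<integral>\<^sup>+ t. ennreal (f (xi_pt \<iota> k g h t)) \<partial>hk_meas k)"

definition haar_SO :: "(real^'n^'n) measure \<Rightarrow> bool" where
  "haar_SO \<mu> \<longleftrightarrow> sets \<mu> = sets borel \<and> emeasure \<mu> (space \<mu>) = 1 \<and> emeasure \<mu> SOn = 1 \<and>
     (\<forall>a\<in>SOn. distr \<mu> borel (\<lambda>g. a ** g) = \<mu>)"

text \<open>Measure on the parameter space SO(n) x (0,\<infinity>) inducing d xi (up to the positive
  constant c_(n,k), irrelevant for null sets).\<close>
definition Xi_meas :: "(real^'n^'n) measure \<Rightarrow> nat \<Rightarrow> ((real^'n^'n) \<times> real) measure" where
  "Xi_meas \<mu> k = \<mu> \<Otimes>\<^sub>M density lborel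
     (\<lambda>h. ennreal (indicator {0<..} h * cosh h ^ k * sinh h ^ (CARD('n) - k - 1)))"

end

theory Submission
  imports Defs "HOL-Real_Asymp.Real_Asymp"
begin

text \<open>
  In the radial variable \<open>u = cosh d(0,x)\<close> the hyperbolic Pythagorean theorem is multiplicative: the
  point at distance \<open>s\<close> from the foot of a plane at distance \<open>h\<close> has \<open>u = cosh h * cosh s\<close>. Averaging
  over rotations and substituting linearly, the integral of \<open>R_k F\<close> over the planes with \<open>h\<close> in a
  compact subset of \<open>(0,\<infinity>)\<close> is bounded by the integral of \<open>F * u powr (k - n)\<close> over a region
  \<open>u \<ge> A > 1\<close>. This settles \<open>p = 1\<close>; for \<open>p > 1\<close> one splits \<open>|f|\<close> at the threshold \<open>u powr -\<beta>\<close> with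
  \<open>\<beta> > k - 1\<close>, which is possible exactly in case (i). Conversely \<open>u powr -(k - 1) / ln u\<close>, cut off to
  \<open>u \<ge> e\<close>, is not integrable over any k-plane and lies in the space as soon as (i) and (ii) fail.
\<close>

section \<open>Rotation invariance and polar coordinates\<close>

text \<open>Keeping \<open>h\<close> in a compact subset of \<open>(0,\<infinity>)\<close> holds
  \<open>u\<close> above a constant \<open>A > 1\<close>. There \<open>sinh\<close> and
  \<open>cosh\<close> are comparable, so that only the sum \<alpha>1 + \<alpha>2 can matter.
  Integration in \<open>h\<close> also smooths the one singular kernel, that of geodesics. The bound
  \<beta> > k - 1 comes from the part of |f| below the threshold: with the volume density of order
  u^(n-2), it contributes the integral of u^(k-2-\<beta>), finite exactly then. The part above is
  controlled by the norm once \<beta>(p - 1) \<le> \<alpha>1 + \<alpha>2 + n - k. For p > 1 both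
  demands can be met exactly if (k - 1)(p - 1) < \<alpha>1 + \<alpha>2 + n - k, which is (i); for p
  = 1 the second one reads \<alpha>1 + \<alpha>2 \<ge> k - n, which lets in the endpoint
  (ii).\<close>

lemma nn_integral_lborel_reflect:
  fixes f :: "'a::euclidean_space \<Rightarrow> ennreal"
  assumes [measurable]: "f \<in> borel_measurable borel"
  shows "(\<integral>\<^sup>+y. f (x - y) \<partial>lborel) = (\<integral>\<^sup>+y. f y \<partial>lborel)"
proof -
  have "lborel = distr lborel borel (\<lambda>y. x + (- 1) *\<^sub>R y)"
    using lborel_affine[of "-1" x] by (simp add: density_1)
  then have "(\<integral>\<^sup>+y. f y \<partial>lborel) = (\<integral>\<^sup>+y. f y \<partial>distr lborel borel (\<lambda>y. x + (- 1) *\<^sub>R y))"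
    by simp
  then show ?thesis
    by (simp add: nn_integral_distr)
qed

text \<open>Both the Lebesgue measure and its image under an isometry are translation invariant, so by
  Tonelli they are proportional; the unit ball shows that the factor is 1.\<close>
lemma lborel_distr_orthogonal_transformation:
  fixes T :: "'a::euclidean_space \<Rightarrow> 'a"
  assumes T: "orthogonal_transformation T"
  shows "distr lborel borel T = lborel"
proof -
  define N where "N = distr lborel borel T"
  have lin: "linear T" using T by (rule orthogonal_transformation_linear)
  then have [measurable]: "T \<in> borel_measurable borel"
    by (intro borel_measurable_continuous_onI linear_continuous_on linear_conv_bounded_linear[THEN iffD1])
  have sN[measurable_cong]: "sets N = sets borel" by (simp add: N_def)
  have [measurable]: "cball (0::'a) 1 \<in> sets borel" by simp
  let ?B = "indicator (cball 0 1) :: 'a \<Rightarrow> ennreal"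
  define V where "V = (\<integral>\<^sup>+y. ?B y \<partial>lborel)"
  have V: "V = ennreal (unit_ball_vol DIM('a))"
    using emeasure_cball[of 1 "0::'a"] by (simp add: V_def)
  have vol: "unit_ball_vol (real DIM('a)) \<noteq> 0"
    by (metis less_irrefl of_nat_0_le_iff unit_ball_vol_pos)
  have V0: "V \<noteq> 0" "V \<noteq> \<infinity>"
    by (auto simp: V vol)
  have "T -` cball 0 1 = cball 0 1"
    using T by (auto simp: orthogonal_transformation_norm)
  then have VN: "(\<integral>\<^sup>+y. ?B y \<partial>N) = V"
    by (simp add: N_def V_def emeasure_distr)
  have trans: "(\<integral>\<^sup>+x. f (x + c) \<partial>N) = (\<integral>\<^sup>+x. f x \<partial>N)"
    if [measurable]: "f \<in> borel_measurable borel" for f :: "'a \<Rightarrow> ennreal" and c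
  proof -
    obtain d where d: "c = T d"
      using orthogonal_transformation_surj[OF T] by (metis surjD)
    have "(\<integral>\<^sup>+x. f (x + c) \<partial>N) = (\<integral>\<^sup>+x. f (T (d + x)) \<partial>lborel)"
      by (simp add: N_def nn_integral_distr d linear_add[OF lin] add.commute)
    also have "\<dots> = (\<integral>\<^sup>+x. f (T x) \<partial>distr lborel borel ((+) d))"
      by (simp add: nn_integral_distr)
    also have "\<dots> = (\<integral>\<^sup>+x. f x \<partial>N)"
      by (simp add: lborel_distr_plus N_def nn_integral_distr)
    finally show ?thesis .
  qed
  have sf: "sigma_finite_measure N"
  proof
    let ?A = "range (\<lambda>n::nat. cball 0 (real n) :: 'a set)"
    have "T -` cball 0 (real n) = cball 0 (real n)" for n :: nat
      using T by (auto simp: orthogonal_transformation_norm)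
    then have "emeasure N (cball 0 (real n)) \<noteq> \<infinity>" for n
      by (auto simp: N_def emeasure_distr emeasure_cball)
    moreover have "\<Union> ?A = UNIV"
      by (auto intro: real_arch_simple)
    ultimately show "\<exists>A. countable A \<and> A \<subseteq> sets N \<and> \<Union> A = space N \<and> (\<forall>a\<in>A. emeasure N a \<noteq> \<infinity>)"
      by (intro exI[of _ ?A]) (auto simp: N_def)
  qed
  interpret P: pair_sigma_finite N lborel
    using sf by (simp add: pair_sigma_finite_def sigma_finite_lborel)
  show ?thesis
  proof (rule measure_eqI)
    fix A assume "A \<in> sets (distr lborel borel T)"
    then have [measurable]: "A \<in> sets borel" by simp
    \<comment> \<open>A double integral: replacing \<open>y\<close> by \<open>x - y\<close> moves
      \<open>x\<close> into the ball indicator, a shift in \<open>N\<close> then moves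
      \<open>y\<close> into \<open>A\<close>, and a shift in \<open>lborel\<close> frees
      \<open>A\<close> of \<open>x\<close>.\<close>
    have "emeasure N A * V = (\<integral>\<^sup>+x. indicator A x * V \<partial>N)"
      by (simp add: nn_integral_multc)
    also have "\<dots> = (\<integral>\<^sup>+x. \<integral>\<^sup>+y. indicator A x * ?B y \<partial>lborel \<partial>N)"
      unfolding V_def by (intro nn_integral_cong nn_integral_cmult[symmetric]) simp
    also have "\<dots> = (\<integral>\<^sup>+x. \<integral>\<^sup>+y. indicator A x * ?B (x - y) \<partial>lborel \<partial>N)"
      by (rule nn_integral_cong,
          rule nn_integral_lborel_reflect[of "\<lambda>y. indicator A x * ?B y" x for x, symmetric]) simp
    also have "\<dots> = (\<integral>\<^sup>+y. \<integral>\<^sup>+x. indicator A x * ?B (x - y) \<partial>N \<partial>lborel)"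
      by (rule P.Fubini'[symmetric]) simp
    also have "\<dots> = (\<integral>\<^sup>+y. \<integral>\<^sup>+x. indicator A (x + y) * ?B x \<partial>N \<partial>lborel)"
      using trans[of "\<lambda>x. indicator A x * ?B (x - y)" y for y] by simp
    also have "\<dots> = (\<integral>\<^sup>+x. \<integral>\<^sup>+y. indicator A (x + y) * ?B x \<partial>lborel \<partial>N)"
      by (rule P.Fubini') simp
    also have "\<dots> = (\<integral>\<^sup>+x. ?B x * emeasure lborel A \<partial>N)"
    proof (intro nn_integral_cong)
      fix x
      have "(\<integral>\<^sup>+y. indicator A (x + y) \<partial>lborel) = emeasure (distr lborel borel ((+) x)) A"
        by (simp add: nn_integral_distr flip: nn_integral_indicator)
      then show "(\<integral>\<^sup>+y. indicator A (x + y) * ?B x \<partial>lborel) = ?B x * emeasure lborel A"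
        by (simp add: nn_integral_multc lborel_distr_plus mult.commute)
    qed
    also have "\<dots> = V * emeasure lborel A"
      by (simp add: nn_integral_multc flip: VN)
    finally show "emeasure (distr lborel borel T) A = emeasure lborel A"
      using V0 by (simp add: N_def mult.commute[of _ V] ennreal_mult_cancel_left)
  qed simp
qed

text \<open>The half-lines \<open>{..a}\<close> are an intersection-stable generator, so the
  sublevel sets of \<open>N\<close> determine the image measure. \<open>N\<close> is abstract
  because it stands both for the norm on \<open>real^'n\<close> and for the root of the sum of
  squares on the product space behind \<open>hk_meas\<close>.\<close>

lemma distr_eq_density_power:
  fixes N :: "'a \<Rightarrow> real" and V :: real
  assumes [measurable]: "N \<in> borel_measurable M" and V: "0 \<le> V" and d: "1 \<le> d"
    and ball: "\<And>r. 0 < r \<Longrightarrow> emeasure M {x \<in> space M. N x \<le> r} = ennreal (V * r ^ d)"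
  shows "distr M borel N = density lborel (\<lambda>r. ennreal (d * V * r ^ (d - 1)) * indicator {0..} r)"
    (is "?L = ?R")
proof (rule measure_eqI_generator_eq_countable)
  let ?E = "range (\<lambda>a::real. {..a})"
  have R: "emeasure ?R {..a} = (if 0 < a then ennreal (V * a ^ d) else 0)" for a
  proof -
    have "emeasure ?R {..a} = (\<integral>\<^sup>+r. ennreal (d * V * r ^ (d - 1)) * indicator {0..a} r \<partial>lborel)"
      by (subst emeasure_density) (auto intro!: nn_integral_cong split: split_indicator)
    also have "\<dots> = (if 0 < a then ennreal (V * a ^ d) else 0)"
    proof (cases "0 \<le> a")
      case True
      have "(\<integral>\<^sup>+r. ennreal (d * V * r ^ (d - 1)) * indicator {0..a} r \<partial>lborel)
          = ennreal (V * a ^ d - V * 0 ^ d)"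
        using V True by (intro nn_integral_FTC_Icc) (auto intro!: derivative_eq_intros)
      then show ?thesis using d True by (cases "a = 0") (auto simp: power_0_left)
    qed auto
    finally show ?thesis .
  qed
  \<comment> \<open>\<open>ball\<close> speaks of positive radii only; letting the radius tend to 0
    covers \<open>a \<le> 0\<close>, and \<open>d \<ge> 1\<close> makes \<open>0 ^ d\<close>
    vanish.\<close>
  have L0: "emeasure ?L {..a} = 0" if "a \<le> 0" for a
  proof -
    have "emeasure ?L {..a} \<le> ennreal (V * r ^ d)" if "0 < r" for r
    proof -
      have "emeasure ?L {..a} = emeasure M {x \<in> space M. N x \<le> a}"
        by (subst emeasure_distr) (auto simp: vimage_def Int_def conj_commute)
      also have "\<dots> \<le> emeasure M {x \<in> space M. N x \<le> r}"
        using that \<open>a \<le> 0\<close> by (intro emeasure_mono) auto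
      finally show ?thesis using ball[OF that] by simp
    qed
    then have "\<forall>\<^sub>F r in at_right 0. emeasure ?L {..a} \<le> ennreal (V * r ^ d)"
      using eventually_at_right_less[of 0] by (auto elim: eventually_mono)
    moreover have "((\<lambda>r. ennreal (V * r ^ d)) \<longlongrightarrow> ennreal (V * 0 ^ d)) (at_right 0)"
      by (intro tendsto_intros) 
    ultimately have "emeasure ?L {..a} \<le> ennreal (V * 0 ^ d)"
      by (intro tendsto_lowerbound[of _ _ "at_right (0::real)"]) auto
    then show ?thesis using d by (simp add: power_0_left)
  qed
  have L: "emeasure ?L {..a} = (if 0 < a then ennreal (V * a ^ d) else 0)" for a
    using L0[of a] ball[of a] by (auto simp: emeasure_distr vimage_def Int_def conj_commute)
  show "Int_stable ?E"
    by (auto simp: Int_stable_def)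
  show "emeasure ?L X = emeasure ?R X" if "X \<in> ?E" for X
    using that L R by auto
  show "sets ?L = sigma_sets UNIV ?E" "sets ?R = sigma_sets UNIV ?E"
    by (simp_all add: borel_eq_atMost)
  let ?A = "range (\<lambda>n::nat. {..real n})"
  show "?A \<subseteq> ?E" "countable ?A" by auto
  show "\<Union> ?A = UNIV" by (auto intro: real_arch_simple)
  show "emeasure ?L a \<noteq> \<infinity>" if "a \<in> ?A" for a
    using that by (auto simp: L split: if_splits)
qed auto

text \<open>The hyperbolic cosine of the distance from the origin, as a function of the squared
  Euclidean norm \<open>s\<close>, which is the square of \<open>tanh\<close> of half that distance.
  For \<open>s > 1\<close> it is negative, and at \<open>s = 1\<close> it is 0 because division by 0
  gives 0; so a cutoff \<open>A \<le> ballcosh ((norm x)\<^sup>2)\<close> with \<open>A > 1\<close>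
  already confines \<open>x\<close> to the unit ball.\<close>

definition ballcosh :: "real \<Rightarrow> real" where
  "ballcosh s = (1 + s) / (1 - s)"

lemma borel_measurable_ballcosh [measurable]: "ballcosh \<in> borel_measurable borel"
  unfolding ballcosh_def by measurable

lemma powr_half_power2: "0 < x \<Longrightarrow> (x\<^sup>2) powr (e / 2) = x powr e" for x e :: real
  by (simp add: powr_powr flip: powr_numeral)

text \<open>In geodesic polar coordinates the volume is sinh(\<rho>)^(d-1) d\<rho>. With u = cosh
  \<rho> one has du = sinh \<rho> d\<rho>, which leaves sinh(\<rho>)^(d-2) = (u^2 - 1)^((d-2)/2) as
  density.\<close>

lemma nn_integral_ballcosh_substitution:
  fixes \<phi> :: "real \<Rightarrow> ennreal"
  assumes [measurable]: "\<phi> \<in> borel_measurable borel" and d: "1 \<le> d"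
  shows "(\<integral>\<^sup>+r. \<phi> (ballcosh (r\<^sup>2)) * ennreal ((2 / (1 - r\<^sup>2)) ^ d * r ^ (d - 1)) * indicator {0..<1} r \<partial>lborel)
       = (\<integral>\<^sup>+u. \<phi> u * ennreal ((u\<^sup>2 - 1) powr ((real d - 2) / 2)) * indicator {1..} u \<partial>lborel)"
proof -
  define f where "f u = \<phi> u * ennreal ((u\<^sup>2 - 1) powr ((real d - 2) / 2))" for u
  define g :: "real \<Rightarrow> real" where "g r = ballcosh (r\<^sup>2)" for r
  define g' :: "real \<Rightarrow> real" where "g' r = 4 * r / (1 - r\<^sup>2)\<^sup>2" for r
  \<comment> \<open>\<open>g'\<close> is unbounded near 1, so the substitution is made on the
    compact intervals \<open>{0..b i}\<close>, which increase to \<open>{0..<1}\<close>; both sides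
    then pass to the limit as measures of increasing sets.\<close>
  define b :: "nat \<Rightarrow> real" where "b i = 1 - 1 / (real i + 2)" for i
  have [measurable]: "f \<in> borel_measurable borel" "g \<in> borel_measurable borel" "g' \<in> borel_measurable borel"
    unfolding f_def g_def g'_def by measurable
  have b: "0 < b i" "b i < 1" for i
    by (auto simp: b_def divide_simps)
  have sq: "r\<^sup>2 < 1" if "0 \<le> r" "r < 1" for r :: real
    using that by (simp add: power_less_one_iff abs_square_less_1)
  have step: "emeasure (density lborel f) {1..g (b i)} = emeasure (density lborel (\<lambda>r. f (g r) * g' r)) {0..b i}" for i
  proof -
    have "(\<integral>\<^sup>+x. f x * indicator {g 0..g (b i)} x \<partial>lborel) =
          (\<integral>\<^sup>+x. f (g x) * g' x * indicator {0..b i} x \<partial>lborel)"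
    proof (rule nn_integral_substitution_aux)
      show "(g has_real_derivative g' x) (at x)" if "x \<in> {0..b i}" for x
      proof -
        have "1 - x\<^sup>2 \<noteq> 0" using sq[of x] that b[of i] by auto
        then show ?thesis
          unfolding g_def ballcosh_def g'_def
          by (auto intro!: derivative_eq_intros simp: power2_eq_square[of "1 - x\<^sup>2"] field_simps)
      qed
      show "continuous_on {0..b i} g'"
        unfolding g'_def using sq b[of i] by (intro continuous_intros) fastforce
    qed (use b in \<open>auto simp: g'_def\<close>)
    moreover have "g 0 = 1" by (simp add: g_def ballcosh_def)
    ultimately show ?thesis by (simp add: emeasure_density)
  qed
  have mono_b: "incseq b"
    by (auto simp: incseq_def b_def frac_le)
  have gmono: "g r \<le> g s" if "0 \<le> r" "r \<le> s" "s < 1" for r s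
  proof -
    have "g s = 2 / (1 - s\<^sup>2) - 1" "g r = 2 / (1 - r\<^sup>2) - 1"
      using that sq[of s] sq[of r] by (auto simp: g_def ballcosh_def field_simps)
    moreover have "2 / (1 - r\<^sup>2) \<le> 2 / (1 - s\<^sup>2)"
      using that sq[of s] by (intro divide_left_mono) (auto simp: power_mono intro!: mult_pos_pos sq)
    ultimately show ?thesis by simp
  qed
  have lim: "b \<longlonglongrightarrow> 1" unfolding b_def by real_asymp
  have U2: "(\<Union>i. {0..b i}) = {0..<1}"
  proof -
    have "\<exists>i. x \<le> b i" if "x < 1" for x
      using order_tendstoD(1)[OF lim that] by (auto simp: eventually_sequentially intro: less_imp_le)
    then show ?thesis using le_less_trans[OF _ b(2)] by auto
  qed
  have U1: "(\<Union>i. {1..g (b i)}) = {1..}"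
  proof -
    have "filterlim (\<lambda>i. g (b i)) at_top sequentially"
      unfolding g_def b_def ballcosh_def by real_asymp
    then have "\<exists>i. x \<le> g (b i)" for x
      by (auto simp: filterlim_at_top eventually_sequentially)
    then show ?thesis by auto
  qed
  have "emeasure (density lborel f) {1..} = (SUP i. emeasure (density lborel f) {1..g (b i)})"
    unfolding U1[symmetric]
  proof (rule SUP_emeasure_incseq[symmetric])
    have "g (b i) \<le> g (b j)" if "i \<le> j" for i j
      using gmono[of "b i" "b j"] b[of i] b[of j] incseqD[OF mono_b that] by linarith
    then show "incseq (\<lambda>i. {1..g (b i)})"
      unfolding incseq_def atLeastatMost_subset_iff by blast
  qed auto
  also have "\<dots> = (SUP i. emeasure (density lborel (\<lambda>r. f (g r) * g' r)) {0..b i})"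
    by (simp add: step)
  also have "\<dots> = emeasure (density lborel (\<lambda>r. f (g r) * g' r)) {0..<1}"
    unfolding U2[symmetric]
    using incseqD[OF mono_b] by (intro SUP_emeasure_incseq) (auto simp: incseq_def)
  finally have "(\<integral>\<^sup>+u. f u * indicator {1..} u \<partial>lborel) = (\<integral>\<^sup>+r. f (g r) * g' r * indicator {0..<1} r \<partial>lborel)"
    by (simp add: emeasure_density)
  also have "\<dots> = (\<integral>\<^sup>+r. \<phi> (ballcosh (r\<^sup>2)) * ennreal ((2 / (1 - r\<^sup>2)) ^ d * r ^ (d - 1)) * indicator {0..<1} r \<partial>lborel)"
  proof (rule nn_integral_cong_AE)
    \<comment> \<open>The origin is left out: for \<open>d = 1\<close> the right side there contains
      \<open>0 ^ 0 = 1\<close>, whereas \<open>g' 0 = 0\<close>.\<close>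
    have "f (g r) * g' r * indicator {0..<1} r =
        \<phi> (ballcosh (r\<^sup>2)) * ennreal ((2 / (1 - r\<^sup>2)) ^ d * r ^ (d - 1)) * indicator {0..<1} r"
      if "r \<noteq> 0" for r
    proof (cases "r \<in> {0..<1}")
      case True
      with that have r: "0 < r" "r < 1" by auto
      \<comment> \<open>\<open>x\<close> is \<open>sinh\<close> of the distance whose half has
        hyperbolic tangent \<open>r\<close>, so \<open>(g r)\<^sup>2 - 1 = x\<^sup>2\<close> is the
        identity cosh^2 - 1 = sinh^2.\<close>
      define x where "x = 2 * r / (1 - r\<^sup>2)"
      have s: "0 < 1 - r\<^sup>2" using sq[of r] r by auto
      then have x: "0 < x" using r by (simp add: x_def)
      have "(g r)\<^sup>2 - 1 = ((1 + r\<^sup>2)\<^sup>2 - (1 - r\<^sup>2)\<^sup>2) / (1 - r\<^sup>2)\<^sup>2"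
        using s by (simp add: g_def ballcosh_def power_divide diff_divide_distrib)
      also have "(1 + r\<^sup>2)\<^sup>2 - (1 - r\<^sup>2)\<^sup>2 = (2 * r)\<^sup>2"
        by (simp add: power2_eq_square algebra_simps)
      finally have "(g r)\<^sup>2 - 1 = x\<^sup>2"
        by (simp add: x_def power_divide)
      then have "((g r)\<^sup>2 - 1) powr ((real d - 2) / 2) = x ^ d / x\<^sup>2"
        using x by (simp add: powr_half_power2 powr_diff powr_realpow)
      also have "x ^ d / x\<^sup>2 * g' r = x ^ d / r"
      proof -
        have "r * g' r = x\<^sup>2"
          by (simp add: x_def g'_def power_divide power2_eq_square)
        then have "g' r = x\<^sup>2 / r"
          using r by (simp add: field_simps)
        then show ?thesis using x by simp
      qed
      also have "\<dots> = (2 / (1 - r\<^sup>2)) ^ d * r ^ (d - 1)"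
        using r d by (cases d) (auto simp: x_def power_mult_distrib power_divide)
      finally have "((g r)\<^sup>2 - 1) powr ((real d - 2) / 2) * g' r = (2 / (1 - r\<^sup>2)) ^ d * r ^ (d - 1)" .
      then show ?thesis
        by (simp add: f_def g_def mult.assoc flip: ennreal_mult')
    qed simp
    then show "AE r in lborel. f (g r) * g' r * indicator {0..<1} r =
        \<phi> (ballcosh (r\<^sup>2)) * ennreal ((2 / (1 - r\<^sup>2)) ^ d * r ^ (d - 1)) * indicator {0..<1} r"
      using AE_lborel_singleton[of 0] by (auto elim: eventually_mono)
  qed
  finally show ?thesis by (simp add: f_def)
qed

lemma nn_integral_radial_hyperbolic:
  fixes N :: "'a \<Rightarrow> real" and V :: real and \<phi> :: "real \<Rightarrow> ennreal"
  assumes [measurable]: "N \<in> borel_measurable M" and V: "0 \<le> V" and d: "1 \<le> d"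
    and ball: "\<And>r. 0 < r \<Longrightarrow> emeasure M {x \<in> space M. N x \<le> r} = ennreal (V * r ^ d)"
    and [measurable]: "\<phi> \<in> borel_measurable borel"
  shows "(\<integral>\<^sup>+x. ennreal (if N x < 1 then (2 / (1 - (N x)\<^sup>2)) ^ d else 0) * \<phi> (ballcosh ((N x)\<^sup>2)) \<partial>M)
       = ennreal (d * V) * (\<integral>\<^sup>+u. \<phi> u * ennreal ((u\<^sup>2 - 1) powr ((real d - 2) / 2)) * indicator {1..} u \<partial>lborel)"
proof -
  let ?H = "\<lambda>r. ennreal (if r < 1 then (2 / (1 - r\<^sup>2)) ^ d else 0) * \<phi> (ballcosh (r\<^sup>2))"
  have "(\<integral>\<^sup>+x. ?H (N x) \<partial>M) = (\<integral>\<^sup>+r. ?H r \<partial>distr M borel N)"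
    by (subst nn_integral_distr) auto
  also have "\<dots> = (\<integral>\<^sup>+r. ennreal (d * V * r ^ (d - 1)) * indicator {0..} r * ?H r \<partial>lborel)"
    by (subst distr_eq_density_power[OF assms(1-4)], assumption)
       (simp add: nn_integral_density)
  also have "\<dots> = (\<integral>\<^sup>+r. ennreal (d * V) * (\<phi> (ballcosh (r\<^sup>2)) *
      ennreal ((2 / (1 - r\<^sup>2)) ^ d * r ^ (d - 1)) * indicator {0..<1} r) \<partial>lborel)"
  proof (rule nn_integral_cong)
    fix r :: real
    have "0 \<le> 2 / (1 - r\<^sup>2)" if "0 \<le> r" "r < 1"
      using that by (simp add: power_le_one)
    then show "ennreal (d * V * r ^ (d - 1)) * indicator {0..} r * ?H r = ennreal (d * V) * (\<phi> (ballcosh (r\<^sup>2)) *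
      ennreal ((2 / (1 - r\<^sup>2)) ^ d * r ^ (d - 1)) * indicator {0..<1} r)"
      using V by (cases "0 \<le> r \<and> r < 1") (auto simp: ennreal_mult mult_ac split: split_indicator)
  qed
  also have "\<dots> = ennreal (d * V) * (\<integral>\<^sup>+u. \<phi> u * ennreal ((u\<^sup>2 - 1) powr ((real d - 2) / 2)) * indicator {1..} u \<partial>lborel)"
    by (subst nn_integral_cmult) (auto simp del: One_nat_def simp: nn_integral_ballcosh_substitution[OF _ d])
  finally show ?thesis .
qed

lemma nn_integral_hvol_radial:
  fixes \<phi> :: "real \<Rightarrow> ennreal"
  assumes [measurable]: "\<phi> \<in> borel_measurable borel"
  shows "(\<integral>\<^sup>+x. \<phi> (ballcosh ((norm x)\<^sup>2)) \<partial>(hvol :: (real^'n) measure))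
       = ennreal (CARD('n) * unit_ball_vol CARD('n)) *
         (\<integral>\<^sup>+u. \<phi> u * ennreal ((u\<^sup>2 - 1) powr ((real CARD('n) - 2) / 2)) * indicator {1..} u \<partial>lborel)"
proof -
  have [measurable]: "ball (0::real^'n) 1 \<in> sets borel" by simp
  have "(\<integral>\<^sup>+x. \<phi> (ballcosh ((norm x)\<^sup>2)) \<partial>(hvol :: (real^'n) measure)) =
    (\<integral>\<^sup>+x. ennreal (if norm (x::real^'n) < 1 then (2 / (1 - (norm x)\<^sup>2)) ^ CARD('n) else 0) *
       \<phi> (ballcosh ((norm x)\<^sup>2)) \<partial>lborel)"
    unfolding hvol_def
    by (subst nn_integral_density, measurable) (auto intro!: nn_integral_cong split: split_indicator)
  also have "\<dots> = ennreal (CARD('n) * unit_ball_vol CARD('n)) *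
         (\<integral>\<^sup>+u. \<phi> u * ennreal ((u\<^sup>2 - 1) powr ((real CARD('n) - 2) / 2)) * indicator {1..} u \<partial>lborel)"
  proof (rule nn_integral_radial_hyperbolic)
    show "emeasure lborel {x \<in> space lborel. norm (x::real^'n) \<le> r} = ennreal (unit_ball_vol CARD('n) * r ^ CARD('n))"
      if "0 < r" for r
      using emeasure_cball[of r "0::real^'n"] that by (simp add: cball_def)
  qed (auto simp: Suc_leI)
  finally show ?thesis .
qed

lemma nn_integral_hk_meas_radial:
  fixes \<phi> :: "real \<Rightarrow> ennreal"
  assumes [measurable]: "\<phi> \<in> borel_measurable borel" and k: "1 \<le> k"
  shows "(\<integral>\<^sup>+t. \<phi> (ballcosh (\<Sum>i<k. (t i)\<^sup>2)) \<partial>hk_meas k)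
       = ennreal (k * unit_ball_vol k) *
         (\<integral>\<^sup>+u. \<phi> u * ennreal ((u\<^sup>2 - 1) powr ((real k - 2) / 2)) * indicator {1..} u \<partial>lborel)"
proof -
  let ?N = "\<lambda>t::nat \<Rightarrow> real. sqrt (\<Sum>i<k. (t i)\<^sup>2)"
  have nn: "0 \<le> (\<Sum>i<k. (t i)\<^sup>2)" for t :: "nat \<Rightarrow> real"
    by (simp add: sum_nonneg)
  have "(\<integral>\<^sup>+t. \<phi> (ballcosh (\<Sum>i<k. (t i)\<^sup>2)) \<partial>hk_meas k) =
    (\<integral>\<^sup>+t. ennreal (if ?N t < 1 then (2 / (1 - (?N t)\<^sup>2)) ^ k else 0) *
       \<phi> (ballcosh ((?N t)\<^sup>2)) \<partial>Pi\<^sub>M {..<k} (\<lambda>_. lborel))"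
    unfolding hk_meas_def
    by (subst nn_integral_density) (auto intro!: nn_integral_cong simp: nn)
  also have "\<dots> = ennreal (k * unit_ball_vol k) *
         (\<integral>\<^sup>+u. \<phi> u * ennreal ((u\<^sup>2 - 1) powr ((real k - 2) / 2)) * indicator {1..} u \<partial>lborel)"
  proof (rule nn_integral_radial_hyperbolic)
    show "emeasure (Pi\<^sub>M {..<k} (\<lambda>_. lborel)) {t \<in> space (Pi\<^sub>M {..<k} (\<lambda>_. lborel)). ?N t \<le> r} =
        ennreal (unit_ball_vol k * r ^ k)" if "0 < r" for r
      using emeasure_cball_aux[of "{..<k}" r] that by (simp add: Int_def conj_commute)
  qed (use k in \<open>auto simp: nn\<close>)
  finally show ?thesis .
qed

section \<open>Totally geodesic planes and Haar averages\<close>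

lemma ballcosh_hdist0: "norm x < 1 \<Longrightarrow> ballcosh ((norm x)\<^sup>2) = cosh (hdist0 x)"
proof -
  assume x: "norm x < 1"
  define r where "r = norm x"
  have r: "0 \<le> r" "r < 1" using x by (auto simp: r_def)
  have "cosh (hdist0 x) = ((1 + r) / (1 - r) + (1 - r) / (1 + r)) / 2"
    unfolding hdist0_def r_def[symmetric] using r by (subst cosh_ln_real) auto
  also have "\<dots> = ((1 + r)\<^sup>2 + (1 - r)\<^sup>2) / (2 * ((1 - r) * (1 + r)))"
    using r by (simp add: add_frac_eq power2_eq_square)
  also have "(1 + r)\<^sup>2 + (1 - r)\<^sup>2 = 2 * (1 + r\<^sup>2)"
    by (simp add: power2_eq_square algebra_simps)
  also have "(1 - r) * (1 + r) = 1 - r\<^sup>2"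
    by (simp add: power2_eq_square algebra_simps)
  also have "2 * (1 + r\<^sup>2) / (2 * (1 - r\<^sup>2)) = ballcosh ((norm x)\<^sup>2)"
    unfolding ballcosh_def r_def by (rule mult_divide_mult_cancel_left) simp
  finally show ?thesis by simp
qed

lemma hdist0_nonneg: "norm x < 1 \<Longrightarrow> 0 \<le> hdist0 x"
  unfolding hdist0_def by (rule ln_ge_zero) (auto simp: field_simps)

text \<open>The right-angled hyperbolic law of cosines. With the inner product zero, the squared
  norm is that of an orthogonal sum, and \<open>1 + N\<close> and \<open>1 - N\<close> each split
  into a factor for \<open>a\<close> and a factor for \<open>x\<close> over the same
  \<open>D\<close>, which cancels in the quotient.\<close>

lemma ballcosh_mobius_add:
  assumes "a \<bullet> x = 0"
  shows "ballcosh ((norm (mobius_add a x))\<^sup>2) = ballcosh ((norm a)\<^sup>2) * ballcosh ((norm x)\<^sup>2)"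
proof -
  define A where "A = (norm a)\<^sup>2"
  define X where "X = (norm x)\<^sup>2"
  define D where "D = 1 + A * X"
  define N where "N = (norm (mobius_add a x))\<^sup>2"
  have "0 \<le> A" "0 \<le> X" by (auto simp: A_def X_def)
  then have D: "0 < D" by (simp add: D_def add_pos_nonneg)
  have "N = ((1 + X)\<^sup>2 * A + (1 - A)\<^sup>2 * X) / D\<^sup>2"
  proof -
    have "mobius_add a x = inverse D *\<^sub>R ((1 + X) *\<^sub>R a + (1 - A) *\<^sub>R x)"
      by (simp add: mobius_add_def assms A_def X_def D_def)
    then have "N = (inverse D)\<^sup>2 * (norm ((1 + X) *\<^sub>R a + (1 - A) *\<^sub>R x))\<^sup>2"
      using D by (simp add: N_def power_mult_distrib)
    also have "(norm ((1 + X) *\<^sub>R a + (1 - A) *\<^sub>R x))\<^sup>2 = (norm ((1 + X) *\<^sub>R a))\<^sup>2 + (norm ((1 - A) *\<^sub>R x))\<^sup>2"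
      by (rule norm_add_Pythagorean) (simp add: orthogonal_def assms)
    finally show ?thesis
      by (simp add: A_def X_def power_mult_distrib divide_inverse power_inverse mult.commute)
  qed
  then have "1 + N = (D\<^sup>2 + ((1 + X)\<^sup>2 * A + (1 - A)\<^sup>2 * X)) / D\<^sup>2"
    "1 - N = (D\<^sup>2 - ((1 + X)\<^sup>2 * A + (1 - A)\<^sup>2 * X)) / D\<^sup>2"
    using D by (simp_all add: add_divide_distrib diff_divide_distrib)
  moreover have "D\<^sup>2 + ((1 + X)\<^sup>2 * A + (1 - A)\<^sup>2 * X) = D * ((1 + A) * (1 + X))"
    "D\<^sup>2 - ((1 + X)\<^sup>2 * A + (1 - A)\<^sup>2 * X) = D * ((1 - A) * (1 - X))"
    by (simp_all add: D_def power2_eq_square algebra_simps)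
  ultimately have "1 + N = (1 + A) * (1 + X) / D" "1 - N = (1 - A) * (1 - X) / D"
    by (simp_all only: power2_eq_square mult_divide_mult_cancel_left[OF less_imp_neq[OF D, symmetric]])
  then show ?thesis
    unfolding N_def[symmetric] A_def[symmetric] X_def[symmetric] ballcosh_def using D by simp
qed

lemma ballcosh_tanh_half: "ballcosh ((tanh (h / 2))\<^sup>2) = cosh h"
proof -
  have c: "0 < cosh (h / 2)" by simp
  have "ballcosh ((tanh (h / 2))\<^sup>2) = ((cosh (h / 2))\<^sup>2 + (sinh (h / 2))\<^sup>2) / ((cosh (h / 2))\<^sup>2 - (sinh (h / 2))\<^sup>2)"
    unfolding ballcosh_def tanh_def power_divide using c
    by (simp add: divide_simps)
  also have "\<dots> = cosh (2 * (h / 2))"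
    unfolding cosh_double by (simp add: cosh_square_eq)
  finally show ?thesis by simp
qed

lemma SOn_orthogonal_transformation: "g \<in> SOn \<Longrightarrow> orthogonal_transformation ((*v) g)"
  by (simp add: SOn_def orthogonal_transformation_matrix)

lemma transpose_in_SOn: "g \<in> SOn \<Longrightarrow> transpose g \<in> SOn"
  by (simp add: SOn_def)

lemma mobius_add_matrix:
  assumes "g \<in> SOn"
  shows "mobius_add (g *v a) (g *v x) = g *v mobius_add a x"
proof -
  have "orthogonal_transformation ((*v) g)" using assms by (rule SOn_orthogonal_transformation)
  then show ?thesis
    by (auto simp: mobius_add_def orthogonal_transformation_def orthogonal_transformation_norm
        matrix_vector_right_distrib matrix_vector_mult_scaleR norm_eq_sqrt_inner)
qed

lemma mat_1_in_SOn: "mat 1 \<in> SOn"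
  by (simp add: SOn_def orthogonal_matrix_id)

text \<open>All planes at distance \<open>h\<close> are rotated copies of one plane, with the same
  parameter \<open>t\<close>. For fixed \<open>t\<close> the Haar integral over \<open>g\<close>
  therefore runs over the orbit of a single point.\<close>

lemma xi_pt_matrix:
  assumes "g \<in> SOn"
  shows "xi_pt \<iota> k g h t = g *v xi_pt \<iota> k (mat 1) h t"
proof -
  have "(\<Sum>i<k. t i *\<^sub>R (g *v ebasis \<iota> i)) = g *v (\<Sum>i<k. t i *\<^sub>R ebasis \<iota> i)"
    by (simp add: linear_sum[OF matrix_vector_mul_linear] matrix_vector_mult_scaleR o_def)
  then show ?thesis
    using mobius_add_matrix[OF assms, of "tanh (h / 2) *\<^sub>R ebasis \<iota> k"]
    by (simp add: xi_pt_def htrans_def matrix_vector_mult_scaleR)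
qed

text \<open>A point of the plane, the foot of the perpendicular and the origin form a right
  triangle. Injectivity is asked on \<open>{..k}\<close>, not just on \<open>{..<k}\<close>, because
  the translation direction has to be orthogonal to the spanning vectors.\<close>

lemma ballcosh_xi_pt:
  fixes \<iota> :: "nat \<Rightarrow> 'n::finite"
  assumes \<iota>: "inj_on \<iota> {..k}" and g: "g \<in> SOn"
  shows "ballcosh ((norm (xi_pt \<iota> k g h t))\<^sup>2) = cosh h * ballcosh (\<Sum>i<k. (t i)\<^sup>2)"
proof -
  let ?x = "\<Sum>i<k. t i *\<^sub>R ebasis \<iota> i"
  have inner: "ebasis \<iota> i \<bullet> ebasis \<iota> j = (if i = j then 1 else 0)" if "i \<le> k" "j \<le> k" for i j
    using inj_onD[OF \<iota>, of i j] that by (auto simp: ebasis_def inner_axis_axis)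
  have "ebasis \<iota> k \<bullet> ?x = 0"
    by (simp add: inner_sum_right inner)
  moreover have "(norm ?x)\<^sup>2 = (\<Sum>i<k. (t i)\<^sup>2)"
    unfolding power2_norm_eq_inner
    by (simp add: inner_sum_right inner_sum_left inner power2_eq_square if_distrib cong: if_cong)
  moreover have "(norm (ebasis \<iota> k))\<^sup>2 = 1"
    unfolding power2_norm_eq_inner by (simp add: inner)
  moreover have "norm (xi_pt \<iota> k g h t) = norm (xi_pt \<iota> k (mat 1) h t)"
    by (subst xi_pt_matrix[OF g])
       (rule orthogonal_transformation_norm[OF SOn_orthogonal_transformation[OF g]])
  ultimately show ?thesis
    using ballcosh_mobius_add[of "tanh (h / 2) *\<^sub>R ebasis \<iota> k" ?x] ballcosh_tanh_half[of h]
    by (simp add: xi_pt_def htrans_def power_mult_distrib)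
qed

section \<open>Haar averages over the rotation group\<close>

lemma borel_measurable_matrix_vector_mult [measurable (raw)]:
  fixes g :: "'a \<Rightarrow> real^'m::finite^'n::finite"
  assumes "g \<in> borel_measurable M" "x \<in> borel_measurable M"
  shows "(\<lambda>w. g w *v x w) \<in> borel_measurable M"
proof -
  have "continuous_on UNIV (\<lambda>p::(real^'m^'n) \<times> (real^'m). fst p *v snd p)"
    unfolding matrix_vector_mult_def by (intro continuous_intros)
  from borel_measurable_continuous_on[OF this measurable_Pair[OF assms, unfolded borel_prod]]
  show ?thesis by simp
qed

lemma borel_measurable_matrix_matrix_mult [measurable (raw)]:
  fixes g :: "'a \<Rightarrow> real^'m::finite^'n::finite" and h :: "'a \<Rightarrow> real^'l::finite^'m"
  assumes "g \<in> borel_measurable M" "h \<in> borel_measurable M"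
  shows "(\<lambda>w. g w ** h w) \<in> borel_measurable M"
proof -
  have "continuous_on UNIV (\<lambda>p::(real^'m^'n) \<times> (real^'l^'m). fst p ** snd p)"
    unfolding matrix_matrix_mult_def by (intro continuous_intros)
  from borel_measurable_continuous_on[OF this measurable_Pair[OF assms, unfolded borel_prod]]
  show ?thesis by simp
qed

lemma borel_measurable_transpose [measurable]:
  "(transpose :: real^'m::finite^'n::finite \<Rightarrow> _) \<in> borel_measurable borel"
  unfolding transpose_def by (intro borel_measurable_continuous_onI continuous_intros)

context
  fixes \<mu> :: "(real^'n::finite^'n) measure"
  assumes haar: "haar_SO \<mu>"
begin

lemma sets_haar: "sets \<mu> = sets borel"
  using haar by (simp add: haar_SO_def)

lemma sigma_finite_haar: "sigma_finite_measure \<mu>"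
  using haar by (intro finite_measure.axioms(1) finite_measureI) (simp add: haar_SO_def)

lemma AE_haar_SOn: "AE g in \<mu>. g \<in> SOn"
proof (rule AE_I)
  \<comment> \<open>\<open>emeasure\<close> of a non-measurable set is 0, so the value 1 forces
    \<open>SOn\<close> to be measurable.\<close>
  have "SOn \<in> sets \<mu>"
    using haar emeasure_notin_sets[of SOn \<mu>] by (auto simp: haar_SO_def)
  then show "emeasure \<mu> (space \<mu> - SOn) = 0" "space \<mu> - SOn \<in> sets \<mu>"
    using haar by (auto simp: emeasure_compl haar_SO_def)
qed auto

lemma nn_integral_haar_left:
  assumes [measurable]: "\<phi> \<in> borel_measurable borel" and "a \<in> SOn"
  shows "(\<integral>\<^sup>+g. \<phi> (a ** g) \<partial>\<mu>) = (\<integral>\<^sup>+g. \<phi> g \<partial>\<mu>)"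
proof -
  note [measurable_cong] = sets_haar
  have "(\<integral>\<^sup>+g. \<phi> g \<partial>\<mu>) = (\<integral>\<^sup>+g. \<phi> g \<partial>distr \<mu> borel (\<lambda>g. a ** g))"
    using haar assms(2) by (simp add: haar_SO_def)
  then show ?thesis by (subst (asm) nn_integral_distr) auto
qed

lemma nn_integral_haar_const: "(\<integral>\<^sup>+g. c \<partial>\<mu>) = c"
  using haar by (simp add: haar_SO_def)

text \<open>Unimodularity: integrate \<open>\<phi> (g\<^sup>T h)\<close> over \<open>g\<close> and \<open>h\<close> in both orders.\<close>
lemma nn_integral_haar_transpose:
  assumes [measurable]: "\<phi> \<in> borel_measurable borel"
  shows "(\<integral>\<^sup>+g. \<phi> (transpose g) \<partial>\<mu>) = (\<integral>\<^sup>+g. \<phi> g \<partial>\<mu>)"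
proof -
  note [measurable_cong] = sets_haar
  interpret P: pair_sigma_finite \<mu> \<mu>
    using sigma_finite_haar by (simp add: pair_sigma_finite_def)
  have "(\<integral>\<^sup>+g. \<phi> g \<partial>\<mu>) = (\<integral>\<^sup>+g. \<integral>\<^sup>+h. \<phi> h \<partial>\<mu> \<partial>\<mu>)"
    by (simp only: nn_integral_haar_const)
  also have "\<dots> = (\<integral>\<^sup>+g. \<integral>\<^sup>+h. \<phi> (transpose g ** h) \<partial>\<mu> \<partial>\<mu>)"
    using AE_haar_SOn
    by (intro nn_integral_cong_AE) (auto simp: nn_integral_haar_left transpose_in_SOn elim!: eventually_mono)
  also have "\<dots> = (\<integral>\<^sup>+h. \<integral>\<^sup>+g. \<phi> (transpose g ** h) \<partial>\<mu> \<partial>\<mu>)"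
    by (rule P.Fubini'[symmetric]) measurable
  also have "\<dots> = (\<integral>\<^sup>+h. \<integral>\<^sup>+g. \<phi> (transpose (transpose h ** g)) \<partial>\<mu> \<partial>\<mu>)"
    by (simp add: matrix_transpose_mul)
  also have "\<dots> = (\<integral>\<^sup>+h. \<integral>\<^sup>+g. \<phi> (transpose g) \<partial>\<mu> \<partial>\<mu>)"
  proof -
    have "(\<integral>\<^sup>+g. \<phi> (transpose (transpose h ** g)) \<partial>\<mu>) = (\<integral>\<^sup>+g. \<phi> (transpose g) \<partial>\<mu>)" if "h \<in> SOn" for h
      using nn_integral_haar_left[of "\<lambda>g. \<phi> (transpose g)" "transpose h"] that
      by (simp add: transpose_in_SOn)
    then show ?thesis
      using AE_haar_SOn by (intro nn_integral_cong_AE) (auto elim!: eventually_mono)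
  qed
  finally show ?thesis by (simp only: nn_integral_haar_const)
qed

lemma nn_integral_haar_right:
  assumes [measurable]: "\<phi> \<in> borel_measurable borel" and a: "a \<in> SOn"
  shows "(\<integral>\<^sup>+g. \<phi> (g ** a) \<partial>\<mu>) = (\<integral>\<^sup>+g. \<phi> g \<partial>\<mu>)"
proof -
  note [measurable_cong] = sets_haar
  have "(\<integral>\<^sup>+g. \<phi> (g ** a) \<partial>\<mu>) = (\<integral>\<^sup>+g. \<phi> (transpose (transpose a ** transpose g)) \<partial>\<mu>)"
    by (simp add: matrix_transpose_mul)
  also have "\<dots> = (\<integral>\<^sup>+g. \<phi> (transpose (transpose a ** g)) \<partial>\<mu>)"
    by (rule nn_integral_haar_transpose[of "\<lambda>g. \<phi> (transpose (transpose a ** g))"]) measurable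
  also have "\<dots> = (\<integral>\<^sup>+g. \<phi> (transpose g) \<partial>\<mu>)"
    by (rule nn_integral_haar_left[of "\<lambda>g. \<phi> (transpose g)"]) (use a in \<open>auto simp: transpose_in_SOn\<close>)
  finally show ?thesis by (simp add: nn_integral_haar_transpose)
qed

text \<open>For n \<ge> 2 the rotations act transitively on spheres, and the rotation taking
  \<open>y\<close> to \<open>z\<close> appears as a factor on the right of \<open>g\<close>. As
  \<open>haar_SO\<close> provides invariance on the left only, this is what unimodularity is
  for.\<close>

lemma haar_average_radial:
  fixes F :: "real^'n \<Rightarrow> ennreal"
  assumes [measurable]: "F \<in> borel_measurable borel" and n: "2 \<le> CARD('n)" and "norm y = norm z"
  shows "(\<integral>\<^sup>+g. F (g *v y) \<partial>\<mu>) = (\<integral>\<^sup>+g. F (g *v z) \<partial>\<mu>)"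
proof -
  note [measurable_cong] = sets_haar
  obtain T where T: "orthogonal_transformation T" "det (matrix T) = 1" "T y = z"
    using rotation_exists[OF n \<open>norm y = norm z\<close>] by blast
  let ?a = "matrix T"
  have "?a \<in> SOn" "?a *v y = z"
    using T by (auto simp: SOn_def orthogonal_transformation_matrix matrix_works)
  then show ?thesis
    using nn_integral_haar_right[of "\<lambda>g. F (g *v y)" ?a]
    by (simp flip: matrix_vector_mul_assoc)
qed

end

lemma sets_hvol [measurable_cong]: "sets hvol = sets borel"
  by (simp add: hvol_def)

lemma nn_integral_hvol_SOn:
  fixes H :: "real^'n::finite \<Rightarrow> ennreal"
  assumes [measurable]: "H \<in> borel_measurable borel" and g: "g \<in> SOn"
  shows "(\<integral>\<^sup>+x. H (g *v x) \<partial>hvol) = (\<integral>\<^sup>+x. H x \<partial>hvol)"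
proof -
  note T = SOn_orthogonal_transformation[OF g]
  have [measurable]: "ball (0::real^'n) 1 \<in> sets borel" by simp
  define w :: "real^'n \<Rightarrow> ennreal" where
    "w x = ennreal (indicator (ball 0 1) x * (2 / (1 - (norm x)\<^sup>2)) ^ CARD('n))" for x
  have [measurable]: "w \<in> borel_measurable borel"
    unfolding w_def by measurable
  have w: "w (g *v x) = w x" for x
    using orthogonal_transformation_norm[OF T] by (simp add: w_def indicator_def)
  have "(\<integral>\<^sup>+x. H (g *v x) \<partial>hvol) = (\<integral>\<^sup>+x. w (g *v x) * H (g *v x) \<partial>lborel)"
    by (simp add: hvol_def nn_integral_density w flip: w_def)
  also have "\<dots> = (\<integral>\<^sup>+x. w x * H x \<partial>distr lborel borel ((*v) g))"
    by (subst nn_integral_distr) auto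
  also have "\<dots> = (\<integral>\<^sup>+x. H x \<partial>hvol)"
    by (simp add: lborel_distr_orthogonal_transformation[OF T] hvol_def nn_integral_density flip: w_def)
  finally show ?thesis .
qed

section \<open>Almost everywhere convergence\<close>

lemma le_sinh_real: "0 \<le> x \<Longrightarrow> x \<le> sinh x" for x :: real
proof -
  assume x: "0 \<le> x"
  have "(\<lambda>x. sinh x - x) 0 \<le> (\<lambda>x. sinh x - x) x"
  proof (rule DERIV_nonneg_imp_nondecreasing[OF x])
    fix y :: real
    show "\<exists>z. ((\<lambda>x. sinh x - x) has_real_derivative z) (at y) \<and> 0 \<le> z"
      by (intro exI[of _ "cosh y - 1"] conjI) (auto intro!: derivative_eq_intros simp: cosh_real_ge_1)
  qed
  then show ?thesis by simp
qed

text \<open>The difference equals \<open>sinh (r + h) * sinh (r - h)\<close>, and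
  \<open>x \<le> sinh x\<close>. With \<open>u = cosh r\<close> this bounds the kernel for
  \<open>k = 1\<close> by a constant times the integrable
  \<open>(r - h) powr (- 1 / 2)\<close>.\<close>

lemma cosh_square_diff_ge:
  fixes a h r :: real
  assumes "0 < a" "a \<le> h" "h \<le> r"
  shows "a * (r - h) \<le> (cosh r)\<^sup>2 - (cosh h)\<^sup>2"
proof -
  have "a * (r - h) \<le> (r + h) * (r - h)"
    using assms by (intro mult_right_mono) auto
  also have "\<dots> \<le> sinh (r + h) * sinh (r - h)"
    using assms by (intro mult_mono le_sinh_real) auto
  also have "\<dots> = (sinh r)\<^sup>2 * (cosh h)\<^sup>2 - (cosh r)\<^sup>2 * (sinh h)\<^sup>2"
    by (simp add: sinh_add sinh_diff power2_eq_square algebra_simps)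
  also have "\<dots> = (cosh r)\<^sup>2 - (cosh h)\<^sup>2"
    by (simp add: sinh_square_eq algebra_simps)
  finally show ?thesis .
qed

lemma nn_integral_powr_minus_half:
  assumes "0 \<le> c"
  shows "(\<integral>\<^sup>+s. ennreal (s powr (- 1 / 2)) * indicator {0..c} s \<partial>lborel) = ennreal (2 * sqrt c)"
proof -
  have "((\<lambda>s. s powr (- 1 / 2)) has_integral (c powr (- 1 / 2 + 1) / (- 1 / 2 + 1))) {0..c}"
    using assms by (intro has_integral_powr_from_0) auto
  from nn_integral_has_integral_lebesgue'[OF _ this] show ?thesis
    using assms by (simp add: powr_half_sqrt mult.commute)
qed

text \<open>The singularity at \<open>cosh h = u\<close> occurs only for \<open>k = 1\<close>, where it is integrable in \<open>h\<close>.\<close>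
lemma kernel_bound:
  fixes a b :: real
  assumes a: "0 < a" and ab: "a \<le> b" and k: "1 \<le> k"
  obtains C where "0 \<le> C" and "\<And>u. (\<integral>\<^sup>+h. ennreal ((u\<^sup>2 - (cosh h)\<^sup>2) powr ((real k - 2) / 2)) *
      indicator {cosh h..} u * indicator {a..b} h \<partial>lborel)
      \<le> ennreal (C * u powr (real k - 2)) * indicator {cosh a..} u"
proof -
  let ?I = "\<lambda>u. (\<integral>\<^sup>+h. ennreal ((u\<^sup>2 - (cosh h)\<^sup>2) powr ((real k - 2) / 2)) *
      indicator {cosh h..} u * indicator {a..b} h \<partial>lborel)"
  have outside: "?I u = 0" if "u < cosh a" for u
  proof -
    have "cosh a \<le> cosh h" if "a \<le> h" for h using a that by (simp add: cosh_real_nonneg_le_iff)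
    then have "\<not> (cosh h \<le> u \<and> a \<le> h)" for h using \<open>u < cosh a\<close> by force
    then have "ennreal ((u\<^sup>2 - (cosh h)\<^sup>2) powr ((real k - 2) / 2)) *
      indicator {cosh h..} u * indicator {a..b} h = 0" for h
      by (auto simp: indicator_def)
    then show ?thesis by (simp only: nn_integral_const mult_zero_left)
  qed
  have uniform: "?I u \<le> ennreal (c * u powr (real k - 2) * (b - a))"
    if c: "\<And>h. a \<le> h \<Longrightarrow> h \<le> b \<Longrightarrow> cosh h \<le> u \<Longrightarrow>
        (u\<^sup>2 - (cosh h)\<^sup>2) powr ((real k - 2) / 2) \<le> c * u powr (real k - 2)" and "0 \<le> c" for c u
  proof -
    have "?I u \<le> (\<integral>\<^sup>+h. ennreal (c * u powr (real k - 2)) * indicator {a..b} h \<partial>lborel)"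
      using c by (intro nn_integral_mono) (auto simp: indicator_def intro!: ennreal_leI)
    also have "\<dots> = ennreal (c * u powr (real k - 2)) * ennreal (b - a)"
      using ab by (simp add: nn_integral_cmult_indicator)
    finally show ?thesis using \<open>0 \<le> c\<close> ab by (simp add: ennreal_mult)
  qed
  have "\<exists>C\<ge>0. \<forall>u\<ge>cosh a. ?I u \<le> ennreal (C * u powr (real k - 2))"
  proof (cases "k = 1")
    case False
    have "?I u \<le> ennreal ((b - a) * u powr (real k - 2))" if u: "cosh a \<le> u" for u
    proof -
      have u1: "1 \<le> u" using u cosh_real_ge_1[of a] by linarith
      have "(u\<^sup>2 - (cosh h)\<^sup>2) powr ((real k - 2) / 2) \<le> 1 * u powr (real k - 2)" if "cosh h \<le> u" for h
      proof -
        \<comment> \<open>Here \<open>k \<ge> 2\<close>, so the exponent is nonnegative and dropping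
          \<open>(cosh h)\<^sup>2\<close> enlarges the power.\<close>
        have "(u\<^sup>2 - (cosh h)\<^sup>2) powr ((real k - 2) / 2) \<le> (u\<^sup>2) powr ((real k - 2) / 2)"
          using False k that by (intro powr_mono2) (auto intro!: power_mono)
        then show ?thesis using u1 by (simp add: powr_half_power2)
      qed
      from uniform[OF this] show ?thesis by (simp add: mult.commute)
    qed
    then show ?thesis using ab by (intro exI[of _ "b - a"]) auto
  next
    case True
    \<comment> \<open>For \<open>u \<ge> cosh (b + 1)\<close> the ratio \<open>cosh h / u\<close> is
      at most \<open>\<theta> < 1\<close>, so \<open>u\<close> is far from the singularity and the
      kernel is of order 1/u. The offset 1 is arbitrary.\<close>
    define \<theta> where "\<theta> = cosh b / cosh (b + 1)"
    have \<theta>: "0 < \<theta>" "\<theta> < 1"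
      using a ab by (auto simp: \<theta>_def cosh_real_nonneg_less_iff)
    then have \<theta>2: "0 < 1 - \<theta>\<^sup>2" by (simp add: power_less_one_iff)
    define C1 where "C1 = (1 - \<theta>\<^sup>2) powr (- 1 / 2)"
    have far: "?I u \<le> ennreal (C1 * (b - a) * u powr (- 1))" if u: "cosh (b + 1) \<le> u" for u
    proof -
      have "(u\<^sup>2 - (cosh h)\<^sup>2) powr (- 1 / 2) \<le> C1 * u powr (- 1)" if "a \<le> h" "h \<le> b" for h
      proof -
        have u0: "0 < u" using u cosh_real_ge_1[of "b + 1"] by linarith
        have "cosh h \<le> cosh b" using that a by (simp add: cosh_real_nonneg_le_iff)
        also have "\<dots> = \<theta> * cosh (b + 1)" by (simp add: \<theta>_def)
        also have "\<dots> \<le> \<theta> * u" using \<theta> u by simp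
        finally have "(cosh h)\<^sup>2 \<le> (\<theta> * u)\<^sup>2" by (intro power_mono) auto
        then have "(1 - \<theta>\<^sup>2) * u\<^sup>2 \<le> u\<^sup>2 - (cosh h)\<^sup>2" by (simp add: power_mult_distrib algebra_simps)
        then have "(u\<^sup>2 - (cosh h)\<^sup>2) powr (- 1 / 2) \<le> ((1 - \<theta>\<^sup>2) * u\<^sup>2) powr (- 1 / 2)"
          using \<theta>2 u0 by (intro powr_mono2') auto
        also have "\<dots> = C1 * u powr (- 1)"
          using u0 powr_half_power2[of u "- 1"] by (simp add: powr_mult C1_def)
        finally show ?thesis .
      qed
      then show ?thesis
        using uniform[of u C1] True by (simp add: C1_def mult_ac)
    qed
    \<comment> \<open>With \<open>u = cosh r\<close> and \<open>r \<le> b + 1\<close>, the variable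
      \<open>r - h\<close> stays in \<open>{0..b + 1}\<close>, where \<open>s powr (- 1 / 2)\<close>
      has integral \<open>2 * sqrt (b + 1)\<close>.\<close>
    define C2 where "C2 = a powr (- 1 / 2) * (2 * sqrt (b + 1))"
    have near: "?I u \<le> ennreal C2" if u: "cosh a \<le> u" "u \<le> cosh (b + 1)" for u
    proof -
      define r where "r = arcosh u"
      have u1: "1 \<le> u" using u cosh_real_ge_1[of a] by linarith
      then have ur: "u = cosh r" "0 \<le> r" by (auto simp: r_def)
      then have r: "r \<le> b + 1" using u a ab by (simp add: cosh_real_nonneg_le_iff)
      let ?f = "\<lambda>s. ennreal (a powr (- 1 / 2)) * (ennreal (s powr (- 1 / 2)) * indicator {0..b + 1} s)"
      have "?I u \<le> (\<integral>\<^sup>+h. ?f (r - h) \<partial>lborel)"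
      proof (intro nn_integral_mono_AE)
        have "ennreal ((u\<^sup>2 - (cosh h)\<^sup>2) powr ((real k - 2) / 2)) * indicator {cosh h..} u * indicator {a..b} h
            \<le> ?f (r - h)" if "h \<noteq> r" for h
        proof (cases "cosh h \<le> u \<and> a \<le> h \<and> h \<le> b")
          case True
          then have h: "a \<le> h" "h < r" using a that by (auto simp: ur cosh_real_nonneg_le_iff)
          have "(u\<^sup>2 - (cosh h)\<^sup>2) powr (- 1 / 2) \<le> (a * (r - h)) powr (- 1 / 2)"
            unfolding ur using a h by (intro powr_mono2' cosh_square_diff_ge) auto
          also have "\<dots> = a powr (- 1 / 2) * (r - h) powr (- 1 / 2)"
            by (simp add: powr_mult)
          finally have "ennreal ((u\<^sup>2 - (cosh h)\<^sup>2) powr (- 1 / 2)) \<le>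
              ennreal (a powr (- 1 / 2)) * ennreal ((r - h) powr (- 1 / 2))"
            by (simp add: ennreal_leI flip: ennreal_mult)
          moreover have "r - h \<in> {0..b + 1}" using h r a by auto
          ultimately show ?thesis using True \<open>k = 1\<close> by (simp add: indicator_def)
        qed (auto simp: indicator_def)
        then show "AE h in lborel. ennreal ((u\<^sup>2 - (cosh h)\<^sup>2) powr ((real k - 2) / 2)) *
            indicator {cosh h..} u * indicator {a..b} h \<le> ?f (r - h)"
          using AE_lborel_singleton[of r] by (auto elim!: eventually_mono)
      qed
      also have "\<dots> = (\<integral>\<^sup>+s. ?f s \<partial>lborel)"
        by (rule nn_integral_lborel_reflect) measurable
      also have "\<dots> = ennreal (a powr (- 1 / 2)) * ennreal (2 * sqrt (b + 1))"
        using nn_integral_powr_minus_half[of "b + 1"] a ab by (simp add: nn_integral_cmult)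
      finally show ?thesis by (simp add: C2_def ennreal_mult')
    qed
    \<comment> \<open>The factor \<open>cosh (b + 1)\<close> turns the constant bound of the near
      range into one with decay 1/u, since \<open>u \<le> cosh (b + 1)\<close> there.\<close>
    define C where "C = max (C1 * (b - a)) (C2 * cosh (b + 1))"
    have C2: "0 \<le> C2" using a ab by (simp add: C2_def)
    have "?I u \<le> ennreal (C * u powr (- 1))" if u: "cosh a \<le> u" for u
    proof (cases "u \<le> cosh (b + 1)")
      case True
      have u1: "1 \<le> u" using u cosh_real_ge_1[of a] by linarith
      have "C2 \<le> C2 * cosh (b + 1) * u powr (- 1)"
        using True u1 C2 by (simp add: powr_minus_divide field_simps mult_left_mono)
      also have "\<dots> \<le> C * u powr (- 1)"
        by (intro mult_right_mono) (auto simp: C_def)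
      finally show ?thesis using near[OF u True] by (meson ennreal_leI order_trans)
    next
      case False
      then have "?I u \<le> ennreal (C1 * (b - a) * u powr (- 1))" by (intro far) auto
      also have "\<dots> \<le> ennreal (C * u powr (- 1))"
        by (intro ennreal_leI mult_right_mono) (auto simp: C_def)
      finally show ?thesis .
    qed
    moreover have "0 \<le> C" using C2 by (simp add: C_def le_max_iff_disj)
    ultimately show ?thesis using True by (intro exI[of _ C]) simp
  qed
  then obtain C where "0 \<le> C" and C: "\<And>u. cosh a \<le> u \<Longrightarrow> ?I u \<le> ennreal (C * u powr (real k - 2))"
    by blast
  show ?thesis
  proof (rule that[OF \<open>0 \<le> C\<close>])
    show "?I u \<le> ennreal (C * u powr (real k - 2)) * indicator {cosh a..} u" for u
      using C[of u] outside[of u] by (cases "cosh a \<le> u") auto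
  qed
qed

section \<open>Measurability in the plane parameters, and tools for exchanging integrals\<close>

lemma borel_measurable_cosh_real [measurable]: "(cosh :: real \<Rightarrow> real) \<in> borel_measurable borel"
  by (intro borel_measurable_continuous_onI continuous_intros)

lemma borel_measurable_sinh_real [measurable]: "(sinh :: real \<Rightarrow> real) \<in> borel_measurable borel"
  by (intro borel_measurable_continuous_onI continuous_intros)

lemma borel_measurable_tanh_real [measurable]: "(tanh :: real \<Rightarrow> real) \<in> borel_measurable borel"
  unfolding tanh_def[abs_def] by measurable

lemma sets_hk_meas [measurable_cong]: "sets (hk_meas k) = sets (Pi\<^sub>M {..<k} (\<lambda>_. lborel))"
  by (simp add: hk_meas_def)

lemma sigma_finite_hk_meas: "sigma_finite_measure (hk_meas k)"
proof -
  have "product_sigma_finite (\<lambda>_::nat. lborel :: real measure)"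
    by (simp add: product_sigma_finite_def sigma_finite_lborel)
  then have "sigma_finite_measure (Pi\<^sub>M {..<k} (\<lambda>_. lborel :: real measure))"
    by (rule product_sigma_finite.sigma_finite) simp
  from sigma_finite_measure.sigma_finite_iff_density_finite[OF this] show ?thesis
    unfolding hk_meas_def by simp
qed

lemma AE_hk_meas: "AE t in hk_meas k. (\<Sum>i<k. (t i)\<^sup>2) < 1"
  unfolding hk_meas_def by (subst AE_density) (auto split: if_splits)

lemma xi_pt_measurable [measurable (raw)]:
  fixes \<iota> :: "nat \<Rightarrow> 'n::finite"
  assumes [measurable]: "g \<in> borel_measurable M" "h \<in> borel_measurable M"
    "t \<in> measurable M (Pi\<^sub>M {..<k} (\<lambda>_. lborel))"
  shows "(\<lambda>w. xi_pt \<iota> k (g w) (h w) (t w)) \<in> borel_measurable M"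
proof -
  have [measurable]: "(\<lambda>w. t w i) \<in> borel_measurable M" if "i \<in> {..<k}" for i
    using measurable_compose[OF assms(3) measurable_component_singleton[OF that]] by simp
  have [measurable]: "(\<lambda>w. \<Sum>i<k. t w i *\<^sub>R (g w *v ebasis \<iota> i)) \<in> borel_measurable M"
    by measurable
  show ?thesis
    unfolding xi_pt_def htrans_def mobius_add_def by measurable
qed

lemma sq_norm_eq_ballcosh:
  assumes "ballcosh s \<noteq> 0"
  shows "s = (ballcosh s - 1) / (ballcosh s + 1)"
proof -
  have s: "1 - s \<noteq> 0" using assms by (auto simp: ballcosh_def)
  then have "ballcosh s - 1 = 2 * s / (1 - s)" "ballcosh s + 1 = 2 / (1 - s)"
    by (auto simp: ballcosh_def field_simps)
  then show ?thesis using s by simp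
qed

lemma ballcosh_pos: "0 \<le> s \<Longrightarrow> s < 1 \<Longrightarrow> 0 < ballcosh s"
  by (simp add: ballcosh_def)

text \<open>Under \<open>u = c * v\<close> the right side is c^(k-1) times the left:
  \<open>du\<close> gives one factor c and the homogeneity of the kernel gives c^(k-2). For
  \<open>c \<ge> 1\<close> and \<open>k \<ge> 1\<close> that factor may be dropped.\<close>

lemma nn_integral_rescaled_le:
  fixes \<Gamma> :: "real \<Rightarrow> ennreal" and c :: real
  assumes [measurable]: "\<Gamma> \<in> borel_measurable borel" and c: "1 \<le> c" and k: "1 \<le> k"
  shows "(\<integral>\<^sup>+v. \<Gamma> (c * v) * ennreal ((v\<^sup>2 - 1) powr ((real k - 2) / 2)) * indicator {1..} v \<partial>lborel)
      \<le> (\<integral>\<^sup>+u. \<Gamma> u * ennreal ((u\<^sup>2 - c\<^sup>2) powr ((real k - 2) / 2)) * indicator {c..} u \<partial>lborel)"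
proof -
  let ?f = "\<lambda>u. \<Gamma> u * ennreal ((u\<^sup>2 - c\<^sup>2) powr ((real k - 2) / 2)) * indicator {c..} u"
  have "\<Gamma> (c * v) * ennreal ((v\<^sup>2 - 1) powr ((real k - 2) / 2)) * indicator {1..} v \<le> ennreal c * ?f (0 + c * v)" for v
  proof (cases "1 \<le> v")
    case True
    have "(v\<^sup>2 - 1) powr ((real k - 2) / 2) \<le> c powr (real k - 1) * (v\<^sup>2 - 1) powr ((real k - 2) / 2)"
      using c k mult_right_mono[of 1 "c powr (real k - 1)" "(v\<^sup>2 - 1) powr ((real k - 2) / 2)"]
      by (simp add: ge_one_powr_ge_zero)
    also have "c powr (real k - 1) = c * c powr (real k - 2)"
      using c by (simp add: powr_diff power2_eq_square)
    also have "c powr (real k - 2) = (c\<^sup>2) powr ((real k - 2) / 2)"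
      using c by (simp add: powr_half_power2)
    also have "c * (c\<^sup>2) powr ((real k - 2) / 2) * (v\<^sup>2 - 1) powr ((real k - 2) / 2) =
        c * ((c * v)\<^sup>2 - c\<^sup>2) powr ((real k - 2) / 2)"
      by (simp add: right_diff_distrib power_mult_distrib flip: powr_mult)
    finally have "ennreal ((v\<^sup>2 - 1) powr ((real k - 2) / 2)) \<le>
        ennreal c * ennreal (((c * v)\<^sup>2 - c\<^sup>2) powr ((real k - 2) / 2))"
      using c by (simp add: ennreal_leI flip: ennreal_mult)
    then have "\<Gamma> (c * v) * ennreal ((v\<^sup>2 - 1) powr ((real k - 2) / 2)) \<le>
        \<Gamma> (c * v) * (ennreal c * ennreal (((c * v)\<^sup>2 - c\<^sup>2) powr ((real k - 2) / 2)))"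
      by (rule mult_left_mono) simp
    moreover have "c \<le> c * v" using True c by simp
    ultimately show ?thesis using True by (simp add: mult_ac)
  qed simp
  then have "(\<integral>\<^sup>+v. \<Gamma> (c * v) * ennreal ((v\<^sup>2 - 1) powr ((real k - 2) / 2)) * indicator {1..} v \<partial>lborel)
      \<le> (\<integral>\<^sup>+v. ennreal c * ?f (0 + c * v) \<partial>lborel)"
    by (rule nn_integral_mono)
  also have "\<dots> = ennreal \<bar>c\<bar> * (\<integral>\<^sup>+v. ?f (0 + c * v) \<partial>lborel)"
    using c by (subst nn_integral_cmult) auto
  also have "\<dots> = (\<integral>\<^sup>+u. ?f u \<partial>lborel)"
    using c by (intro nn_integral_real_affine[symmetric]) auto
  finally show ?thesis .
qed

text \<open>After Tonelli the rotation is undone in the integral over \<open>x\<close>, since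
  \<open>hvol\<close> and \<open>K\<close> are both invariant; the Haar measure has mass 1.\<close>

lemma nn_integral_hvol_haar_average:
  fixes F K :: "real^'n::finite \<Rightarrow> ennreal"
  assumes haar: "haar_SO \<mu>"
    and [measurable]: "F \<in> borel_measurable borel" "K \<in> borel_measurable borel"
    and K: "\<And>g x. g \<in> SOn \<Longrightarrow> K (g *v x) = K x"
  shows "(\<integral>\<^sup>+x. (\<integral>\<^sup>+g. F (g *v x) \<partial>\<mu>) * K x \<partial>hvol) = (\<integral>\<^sup>+x. F x * K x \<partial>hvol)"
proof -
  note [measurable_cong] = sets_haar[OF haar]
  have [measurable]: "ball (0::real^'n) 1 \<in> sets borel" by simp
  have "sigma_finite_measure (hvol :: (real^'n) measure)"
    unfolding hvol_def
    by (subst sigma_finite_measure.sigma_finite_iff_density_finite) (auto intro: sigma_finite_lborel)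
  then interpret P: pair_sigma_finite \<mu> "hvol :: (real^'n) measure"
    using sigma_finite_haar[OF haar] by (simp add: pair_sigma_finite_def)
  have "(\<integral>\<^sup>+x. (\<integral>\<^sup>+g. F (g *v x) \<partial>\<mu>) * K x \<partial>hvol) = (\<integral>\<^sup>+x. \<integral>\<^sup>+g. F (g *v x) * K x \<partial>\<mu> \<partial>hvol)"
    by (rule nn_integral_cong, rule nn_integral_multc[symmetric]) measurable
  also have "\<dots> = (\<integral>\<^sup>+g. \<integral>\<^sup>+x. F (g *v x) * K x \<partial>hvol \<partial>\<mu>)"
    by (rule P.Fubini') measurable
  also have "\<dots> = (\<integral>\<^sup>+g. \<integral>\<^sup>+x. F x * K x \<partial>hvol \<partial>\<mu>)"
  proof -
    have "(\<integral>\<^sup>+x. F (g *v x) * K x \<partial>hvol) = (\<integral>\<^sup>+x. F x * K x \<partial>hvol)" if "g \<in> SOn" for g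
      using nn_integral_hvol_SOn[of "\<lambda>x. F x * K x" g] that K[OF that] by simp
    then show ?thesis
      using AE_haar_SOn[OF haar] by (intro nn_integral_cong_AE) (auto elim!: eventually_mono)
  qed
  finally show ?thesis by (simp only: nn_integral_haar_const[OF haar])
qed

text \<open>\<open>Xi_meas\<close> has a density in \<open>h\<close> with respect to the product
  with \<open>lborel\<close>, and this density vanishes for \<open>h \<le> 0\<close>. Exceptional
  sets may therefore be measured by plain Lebesgue measure on the positive half-line.\<close>

lemma AE_Xi_measI:
  fixes \<mu> :: "(real^'n::finite^'n) measure"
  assumes haar: "haar_SO \<mu>" and AE: "AE gh in \<mu> \<Otimes>\<^sub>M lborel. 0 < snd gh \<longrightarrow> P gh"
  shows "AE gh in Xi_meas \<mu> k. P gh"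
proof -
  define w where "w h = ennreal (indicator {0<..} h * cosh h ^ k * sinh h ^ (CARD('n) - k - 1))" for h
  have [measurable]: "w \<in> borel_measurable borel" unfolding w_def by measurable
  have "sigma_finite_measure (density lborel w)"
    by (subst sigma_finite_measure.sigma_finite_iff_density_finite) (auto simp: w_def intro: sigma_finite_lborel)
  then have "density \<mu> (\<lambda>_. 1) \<Otimes>\<^sub>M density lborel w = density (\<mu> \<Otimes>\<^sub>M lborel) (\<lambda>(g, h). 1 * w h)"
    by (intro pair_measure_density) (auto intro: sigma_finite_lborel)
  then have Xi: "Xi_meas \<mu> k = density (\<mu> \<Otimes>\<^sub>M lborel) (\<lambda>gh. w (snd gh))"
    by (simp add: Xi_meas_def density_1 case_prod_beta' w_def[abs_def])
  show ?thesis
    unfolding Xi using AE by (subst AE_density) (auto simp: w_def indicator_def elim!: eventually_mono)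
qed

section \<open>Averaging the plane integrals over rotations and distances\<close>

context
  fixes \<iota> :: "nat \<Rightarrow> 'n::finite" and k :: nat and \<mu> :: "(real^'n^'n) measure" and F :: "real^'n \<Rightarrow> ennreal"
  assumes n: "2 \<le> CARD('n)" and k: "1 \<le> k" and \<iota>: "inj_on \<iota> {..k}" and haar: "haar_SO \<mu>"
    and F [measurable]: "F \<in> borel_measurable borel"
begin

text \<open>The spherical mean of \<open>F\<close> as a function of u = cosh d(0,x):
  \<open>sqrt ((u - 1) / (u + 1))\<close> is \<open>tanh\<close> of half the distance, the Euclidean
  radius of that sphere. \<open>ebasis \<iota> 0\<close> is just some unit vector.\<close>

definition "radial_profile u = (\<integral>\<^sup>+g. F (g *v (sqrt ((u - 1) / (u + 1)) *\<^sub>R ebasis \<iota> 0)) \<partial>\<mu>)"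

lemma radial_profile_measurable [measurable]: "radial_profile \<in> borel_measurable borel"
proof -
  note [measurable_cong] = sets_haar[OF haar]
  interpret sigma_finite_measure \<mu> using sigma_finite_haar[OF haar] .
  show ?thesis unfolding radial_profile_def[abs_def] by measurable
qed

lemma haar_average_eq_radial_profile:
  assumes "0 < ballcosh ((norm y)\<^sup>2)"
  shows "(\<integral>\<^sup>+g. F (g *v y) \<partial>\<mu>) = radial_profile (ballcosh ((norm y)\<^sup>2))"
  unfolding radial_profile_def
proof (rule haar_average_radial[OF haar F n])
  have "(norm y)\<^sup>2 = (ballcosh ((norm y)\<^sup>2) - 1) / (ballcosh ((norm y)\<^sup>2) + 1)"
    using assms by (intro sq_norm_eq_ballcosh) auto
  then have "norm y = sqrt ((ballcosh ((norm y)\<^sup>2) - 1) / (ballcosh ((norm y)\<^sup>2) + 1))"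
    by (metis norm_ge_zero real_sqrt_unique)
  then show "norm y = norm (sqrt ((ballcosh ((norm y)\<^sup>2) - 1) / (ballcosh ((norm y)\<^sup>2) + 1)) *\<^sub>R (ebasis \<iota> 0 :: real^'n))"
    by (metis abs_norm_cancel ebasis_def mult.right_neutral norm_axis_1 norm_scaleR)
qed

text \<open>For fixed \<open>t\<close> the average over \<open>g\<close> is the spherical mean at
  the product of \<open>cosh h\<close> and the \<open>ballcosh\<close> value of \<open>t\<close>, so
  the integral over the plane reduces to one variable. The only loss is the factor (cosh h)^(k-1)
  dropped in \<open>nn_integral_rescaled_le\<close>.\<close>

lemma haar_average_Rk_le:
  "(\<integral>\<^sup>+g. (\<integral>\<^sup>+t. F (xi_pt \<iota> k g h t) \<partial>hk_meas k) \<partial>\<mu>) \<le> ennreal (k * unit_ball_vol k) *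
    (\<integral>\<^sup>+u. radial_profile u * ennreal ((u\<^sup>2 - (cosh h)\<^sup>2) powr ((real k - 2) / 2)) * indicator {cosh h..} u \<partial>lborel)"
proof -
  note [measurable_cong] = sets_haar[OF haar]
  interpret P: pair_sigma_finite \<mu> "hk_meas k"
    using sigma_finite_haar[OF haar] sigma_finite_hk_meas by (simp add: pair_sigma_finite_def)
  have "(\<integral>\<^sup>+g. (\<integral>\<^sup>+t. F (xi_pt \<iota> k g h t) \<partial>hk_meas k) \<partial>\<mu>) =
      (\<integral>\<^sup>+t. (\<integral>\<^sup>+g. F (xi_pt \<iota> k g h t) \<partial>\<mu>) \<partial>hk_meas k)"
    by (rule P.Fubini'[symmetric]) measurable
  also have "\<dots> = (\<integral>\<^sup>+t. radial_profile (cosh h * ballcosh (\<Sum>i<k. (t i)\<^sup>2)) \<partial>hk_meas k)"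
  proof (rule nn_integral_cong_AE)
    have "(\<integral>\<^sup>+g. F (xi_pt \<iota> k g h t) \<partial>\<mu>) = radial_profile (cosh h * ballcosh (\<Sum>i<k. (t i)\<^sup>2))"
      if "(\<Sum>i<k. (t i)\<^sup>2) < 1" for t
    proof -
      note bc = ballcosh_xi_pt[OF \<iota> mat_1_in_SOn, of h t]
      have "0 < ballcosh ((norm (xi_pt \<iota> k (mat 1) h t))\<^sup>2)"
        unfolding bc using that by (intro mult_pos_pos ballcosh_pos) (auto intro: sum_nonneg)
      then have "(\<integral>\<^sup>+g. F (g *v xi_pt \<iota> k (mat 1) h t) \<partial>\<mu>) = radial_profile (cosh h * ballcosh (\<Sum>i<k. (t i)\<^sup>2))"
        unfolding bc[symmetric] by (rule haar_average_eq_radial_profile)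
      moreover have "(\<integral>\<^sup>+g. F (xi_pt \<iota> k g h t) \<partial>\<mu>) = (\<integral>\<^sup>+g. F (g *v xi_pt \<iota> k (mat 1) h t) \<partial>\<mu>)"
        using AE_haar_SOn[OF haar] by (intro nn_integral_cong_AE) (auto simp: xi_pt_matrix[of _ \<iota> k h t] elim!: eventually_mono)
      ultimately show ?thesis by simp
    qed
    then show "AE t in hk_meas k. (\<integral>\<^sup>+g. F (xi_pt \<iota> k g h t) \<partial>\<mu>) = radial_profile (cosh h * ballcosh (\<Sum>i<k. (t i)\<^sup>2))"
      using AE_hk_meas[of k] by (auto elim!: eventually_mono)
  qed
  also have "\<dots> = ennreal (k * unit_ball_vol k) *
      (\<integral>\<^sup>+v. radial_profile (cosh h * v) * ennreal ((v\<^sup>2 - 1) powr ((real k - 2) / 2)) * indicator {1..} v \<partial>lborel)"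
    by (rule nn_integral_hk_meas_radial[of "\<lambda>v. radial_profile (cosh h * v)"]) (use k in auto)
  also have "\<dots> \<le> ennreal (k * unit_ball_vol k) *
      (\<integral>\<^sup>+u. radial_profile u * ennreal ((u\<^sup>2 - (cosh h)\<^sup>2) powr ((real k - 2) / 2)) * indicator {cosh h..} u \<partial>lborel)"
    by (intro mult_left_mono nn_integral_rescaled_le k) (auto simp: cosh_real_ge_1)
  finally show ?thesis .
qed

text \<open>For \<open>u \<ge> A > 1\<close> one has u^2 - 1 \<ge> (1 - 1/A^2) u^2, so the volume
  density in \<open>u\<close> is at least c u^(n-2). The weight u^(k-n) in the volume integral thus
  controls u^(k-2) in the integral over \<open>u\<close>.\<close>

lemma nn_integral_radial_profile_finite:
  assumes A: "1 < A"
    and fin: "(\<integral>\<^sup>+x. F x * (ennreal (ballcosh ((norm x)\<^sup>2) powr (real k - real CARD('n))) *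
          indicator {A..} (ballcosh ((norm x)\<^sup>2))) \<partial>hvol) < \<infinity>"
  shows "(\<integral>\<^sup>+u. radial_profile u * (ennreal (u powr (real k - 2)) * indicator {A..} u) \<partial>lborel) < \<infinity>"
proof -
  let ?n = "real CARD('n)"
  define K where "K u = ennreal (u powr (real k - ?n)) * indicator {A..} u" for u
  have [measurable]: "K \<in> borel_measurable borel" unfolding K_def by measurable
  define c where "c = (1 - 1 / A\<^sup>2) powr ((?n - 2) / 2)"
  have "0 < unit_ball_vol (real CARD('n))" by simp
  then have vol: "unit_ball_vol (real CARD('n)) \<noteq> 0" by (rule less_imp_neq[symmetric])
  have A2: "0 < 1 - 1 / A\<^sup>2" using A by (simp add: one_less_power)
  then have c: "0 < c" unfolding c_def by (metis powr_gt_zero less_irrefl)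
  have "ennreal (CARD('n) * unit_ball_vol CARD('n)) *
         (\<integral>\<^sup>+u. radial_profile u * K u * ennreal ((u\<^sup>2 - 1) powr ((?n - 2) / 2)) * indicator {1..} u \<partial>lborel)
      = (\<integral>\<^sup>+x. radial_profile (ballcosh ((norm x)\<^sup>2)) * K (ballcosh ((norm x)\<^sup>2)) \<partial>(hvol :: (real^'n) measure))"
    by (rule nn_integral_hvol_radial[symmetric, of "\<lambda>u. radial_profile u * K u"]) measurable
  also have "\<dots> = (\<integral>\<^sup>+x. (\<integral>\<^sup>+g. F (g *v x) \<partial>\<mu>) * K (ballcosh ((norm x)\<^sup>2)) \<partial>hvol)"
  proof (rule nn_integral_cong)
    fix x :: "real^'n"
    show "radial_profile (ballcosh ((norm x)\<^sup>2)) * K (ballcosh ((norm x)\<^sup>2)) = (\<integral>\<^sup>+g. F (g *v x) \<partial>\<mu>) * K (ballcosh ((norm x)\<^sup>2))"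
      using A by (cases "A \<le> ballcosh ((norm x)\<^sup>2)") (auto simp: haar_average_eq_radial_profile K_def)
  qed
  also have "\<dots> = (\<integral>\<^sup>+x. F x * K (ballcosh ((norm x)\<^sup>2)) \<partial>hvol)"
    by (rule nn_integral_hvol_haar_average[OF haar])
       (auto simp: orthogonal_transformation_norm[OF SOn_orthogonal_transformation])
  also have "\<dots> < \<infinity>"
    using fin by (simp add: K_def)
  finally have *: "(\<integral>\<^sup>+u. radial_profile u * K u * ennreal ((u\<^sup>2 - 1) powr ((?n - 2) / 2)) * indicator {1..} u \<partial>lborel) < \<infinity>"
    using vol by (auto simp: ennreal_mult_less_top)
  have "ennreal c * (\<integral>\<^sup>+u. radial_profile u * (ennreal (u powr (real k - 2)) * indicator {A..} u) \<partial>lborel)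
      = (\<integral>\<^sup>+u. ennreal c * (radial_profile u * (ennreal (u powr (real k - 2)) * indicator {A..} u)) \<partial>lborel)"
    by (rule nn_integral_cmult[symmetric]) measurable
  also have "\<dots> \<le> (\<integral>\<^sup>+u. radial_profile u * K u * ennreal ((u\<^sup>2 - 1) powr ((?n - 2) / 2)) * indicator {1..} u \<partial>lborel)"
  proof (rule nn_integral_mono)
    fix u :: real
    show "ennreal c * (radial_profile u * (ennreal (u powr (real k - 2)) * indicator {A..} u)) \<le>
        radial_profile u * K u * ennreal ((u\<^sup>2 - 1) powr ((?n - 2) / 2)) * indicator {1..} u"
    proof (cases "A \<le> u")
      case True
      then have u: "1 < u" using A by simp
      have "1 / u\<^sup>2 \<le> 1 / A\<^sup>2" using True A by (intro divide_left_mono power_mono) auto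
      then have "(1 - 1 / A\<^sup>2) * u\<^sup>2 \<le> u\<^sup>2 - 1" using u by (simp add: field_simps)
      then have "((1 - 1 / A\<^sup>2) * u\<^sup>2) powr ((?n - 2) / 2) \<le> (u\<^sup>2 - 1) powr ((?n - 2) / 2)"
        using n A2 by (intro powr_mono2) auto
      then have "c * u powr (?n - 2) \<le> (u\<^sup>2 - 1) powr ((?n - 2) / 2)"
        using u by (simp add: powr_mult powr_half_power2 c_def)
      then have "u powr (real k - ?n) * (c * u powr (?n - 2)) \<le> u powr (real k - ?n) * (u\<^sup>2 - 1) powr ((?n - 2) / 2)"
        by (rule mult_left_mono) simp
      moreover have "u powr (real k - ?n) * (c * u powr (?n - 2)) = c * u powr (real k - 2)"
        by (simp add: mult.left_commute flip: powr_add)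
      ultimately have "ennreal (c * u powr (real k - 2)) \<le> ennreal (u powr (real k - ?n) * (u\<^sup>2 - 1) powr ((?n - 2) / 2))"
        by (intro ennreal_leI) simp
      then have "ennreal c * ennreal (u powr (real k - 2)) \<le> ennreal (u powr (real k - ?n)) * ennreal ((u\<^sup>2 - 1) powr ((?n - 2) / 2))"
        using c by (simp add: ennreal_mult)
      then have "radial_profile u * (ennreal c * ennreal (u powr (real k - 2))) \<le>
          radial_profile u * (ennreal (u powr (real k - ?n)) * ennreal ((u\<^sup>2 - 1) powr ((?n - 2) / 2)))"
        by (rule mult_left_mono) simp
      then show ?thesis using True u by (simp add: K_def mult_ac)
    qed simp
  qed
  also have "\<dots> < \<infinity>" by (rule *)
  finally show ?thesis
    using c by (auto simp: ennreal_mult_less_top less_top[symmetric])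
qed

text \<open>By Tonelli, the integral of \<open>R\<^sub>k F\<close> over the planes at distance between \<open>a\<close> and \<open>b\<close> is the
  integral of \<open>F\<close> against the dual kernel.\<close>
lemma AE_Rk_finite:
  assumes fin: "\<And>A. 1 < A \<Longrightarrow> (\<integral>\<^sup>+x. F x * (ennreal (ballcosh ((norm x)\<^sup>2) powr (real k - real CARD('n))) *
          indicator {A..} (ballcosh ((norm x)\<^sup>2))) \<partial>hvol) < \<infinity>"
  shows "AE gh in Xi_meas \<mu> k. (\<integral>\<^sup>+t. F (xi_pt \<iota> k (fst gh) (snd gh) t) \<partial>hk_meas k) < \<infinity>"
proof (rule AE_Xi_measI[OF haar])
  note [measurable_cong] = sets_haar[OF haar]
  define R where "R g h = (\<integral>\<^sup>+t. F (xi_pt \<iota> k g h t) \<partial>hk_meas k)" for g h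
  interpret Hk: sigma_finite_measure "hk_meas k" by (rule sigma_finite_hk_meas)
  have R_measurable [measurable]: "(\<lambda>gh. R (fst gh) (snd gh)) \<in> borel_measurable (borel \<Otimes>\<^sub>M borel)"
    unfolding R_def by measurable
  interpret P: pair_sigma_finite \<mu> "lborel :: real measure"
    using sigma_finite_haar[OF haar] by (simp add: pair_sigma_finite_def sigma_finite_lborel)
  have slab: "AE gh in \<mu> \<Otimes>\<^sub>M lborel. snd gh \<in> {a..b} \<longrightarrow> R (fst gh) (snd gh) < \<infinity>" if a: "0 < a" and ab: "a \<le> b" for a b
  proof -
    let ?e = "(real k - 2) / 2"
    obtain C where "0 \<le> C" and C: "\<And>u. (\<integral>\<^sup>+h. ennreal ((u\<^sup>2 - (cosh h)\<^sup>2) powr ?e) *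
      indicator {cosh h..} u * indicator {a..b} h \<partial>lborel)
      \<le> ennreal (C * u powr (real k - 2)) * indicator {cosh a..} u"
      by (rule kernel_bound[OF a ab k]) blast
    let ?V = "ennreal (k * unit_ball_vol k)"
    have [measurable]: "(\<lambda>x::real \<times> real. indicator {cosh (fst x)..} (snd x) :: ennreal) \<in> borel_measurable (borel \<Otimes>\<^sub>M borel)"
      "(\<lambda>x::real \<times> real. indicator {cosh (snd x)..} (fst x) :: ennreal) \<in> borel_measurable (borel \<Otimes>\<^sub>M borel)"
      "(\<lambda>x::real. indicator {cosh x..} u :: ennreal) \<in> borel_measurable borel" for u
      unfolding indicator_def atLeast_iff by measurable
    have "(\<integral>\<^sup>+gh. R (fst gh) (snd gh) * indicator {a..b} (snd gh) \<partial>(\<mu> \<Otimes>\<^sub>M lborel)) =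
        (\<integral>\<^sup>+h. \<integral>\<^sup>+g. R g h * indicator {a..b} h \<partial>\<mu> \<partial>lborel)"
      by (subst P.nn_integral_snd[symmetric]) (auto simp: case_prod_beta')
    also have "\<dots> = (\<integral>\<^sup>+h. (\<integral>\<^sup>+g. R g h \<partial>\<mu>) * indicator {a..b} h \<partial>lborel)"
      by (rule nn_integral_cong, rule nn_integral_multc) (unfold R_def, measurable)
    also have "\<dots> \<le> (\<integral>\<^sup>+h. ?V * (\<integral>\<^sup>+u. radial_profile u * ennreal ((u\<^sup>2 - (cosh h)\<^sup>2) powr ?e) *
        indicator {cosh h..} u * indicator {a..b} h \<partial>lborel) \<partial>lborel)"
    proof (rule nn_integral_mono)
      fix h :: real
      have "(\<integral>\<^sup>+g. R g h \<partial>\<mu>) * indicator {a..b} h \<le> ?V * (\<integral>\<^sup>+u. radial_profile u * ennreal ((u\<^sup>2 - (cosh h)\<^sup>2) powr ?e) *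
        indicator {cosh h..} u \<partial>lborel) * indicator {a..b} h"
        unfolding R_def by (intro mult_right_mono haar_average_Rk_le) auto
      also have "\<dots> = ?V * (\<integral>\<^sup>+u. radial_profile u * ennreal ((u\<^sup>2 - (cosh h)\<^sup>2) powr ?e) *
        indicator {cosh h..} u * indicator {a..b} h \<partial>lborel)"
        by (subst nn_integral_multc) (auto simp: mult.assoc)
      finally show "(\<integral>\<^sup>+g. R g h \<partial>\<mu>) * indicator {a..b} h \<le> \<dots>" .
    qed
    also have "\<dots> = ?V * (\<integral>\<^sup>+h. (\<integral>\<^sup>+u. radial_profile u * ennreal ((u\<^sup>2 - (cosh h)\<^sup>2) powr ?e) *
        indicator {cosh h..} u * indicator {a..b} h \<partial>lborel) \<partial>lborel)"
      by (rule nn_integral_cmult) measurable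
    also have "\<dots> = ?V * (\<integral>\<^sup>+u. (\<integral>\<^sup>+h. radial_profile u * ennreal ((u\<^sup>2 - (cosh h)\<^sup>2) powr ?e) *
        indicator {cosh h..} u * indicator {a..b} h \<partial>lborel) \<partial>lborel)"
      by (subst lborel_pair.Fubini') auto
    also have "\<dots> = ?V * (\<integral>\<^sup>+u. radial_profile u * (\<integral>\<^sup>+h. ennreal ((u\<^sup>2 - (cosh h)\<^sup>2) powr ?e) *
        indicator {cosh h..} u * indicator {a..b} h \<partial>lborel) \<partial>lborel)"
      by (intro arg_cong[where f = "\<lambda>x. ?V * x"] nn_integral_cong)
         (subst nn_integral_cmult[symmetric], auto simp: mult.assoc)
    also have "\<dots> \<le> ?V * (\<integral>\<^sup>+u. radial_profile u * (ennreal (C * u powr (real k - 2)) * indicator {cosh a..} u) \<partial>lborel)"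
      by (intro mult_left_mono nn_integral_mono C) auto
    also have "\<dots> = ?V * (\<integral>\<^sup>+u. ennreal C * (radial_profile u * (ennreal (u powr (real k - 2)) * indicator {cosh a..} u)) \<partial>lborel)"
      using \<open>0 \<le> C\<close> by (simp add: ennreal_mult' mult_ac)
    also have "\<dots> = ?V * (ennreal C * (\<integral>\<^sup>+u. radial_profile u * (ennreal (u powr (real k - 2)) * indicator {cosh a..} u) \<partial>lborel))"
      by (subst nn_integral_cmult) auto
    also have "\<dots> < \<infinity>"
    proof -
      \<comment> \<open>The lower end \<open>a > 0\<close> of the slab supplies a cutoff strictly
        above 1.\<close>
      have "1 < cosh a" using a cosh_real_nonneg_less_iff[of 0 a] by simp
      from nn_integral_radial_profile_finite[OF this fin[OF this]] show ?thesis
        by (simp add: ennreal_mult_less_top)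
    qed
    finally have "AE gh in \<mu> \<Otimes>\<^sub>M lborel. R (fst gh) (snd gh) * indicator {a..b} (snd gh) \<noteq> \<infinity>"
      by (intro nn_integral_PInf_AE) auto
    then show ?thesis
      by (rule eventually_mono) (auto simp: less_top[symmetric])
  qed
  \<comment> \<open>These intervals exhaust \<open>(0,\<infinity>)\<close>, and countably many null
    sets may be discarded together.\<close>
  have "AE gh in \<mu> \<Otimes>\<^sub>M lborel. \<forall>m::nat. snd gh \<in> {1 / (real m + 1)..real m + 1} \<longrightarrow> R (fst gh) (snd gh) < \<infinity>"
    unfolding AE_all_countable
  proof
    fix m :: nat
    have "1 / (real m + 1) \<le> 1" by (simp add: divide_le_eq)
    then have "1 / (real m + 1) \<le> real m + 1" by linarith
    then show "AE gh in \<mu> \<Otimes>\<^sub>M lborel. snd gh \<in> {1 / (real m + 1)..real m + 1} \<longrightarrow> R (fst gh) (snd gh) < \<infinity>"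
      by (intro slab) auto
  qed
  then show "AE gh in \<mu> \<Otimes>\<^sub>M lborel. 0 < snd gh \<longrightarrow> (\<integral>\<^sup>+t. F (xi_pt \<iota> k (fst gh) (snd gh) t) \<partial>hk_meas k) < \<infinity>"
  proof (rule eventually_mono, intro impI)
    fix gh :: "(real^'n^'n) \<times> real"
    assume *: "\<forall>m::nat. snd gh \<in> {1 / (real m + 1)..real m + 1} \<longrightarrow> R (fst gh) (snd gh) < \<infinity>" and "0 < snd gh"
    obtain m :: nat where "max (snd gh) (1 / snd gh) \<le> real m" using real_arch_simple by blast
    then have m: "snd gh \<le> real m" "1 / snd gh \<le> real m" by auto
    then have "1 \<le> (real m + 1) * snd gh" using \<open>0 < snd gh\<close> by (simp add: field_simps)
    then have "1 / (real m + 1) \<le> snd gh" by (simp add: field_simps)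
    then show "(\<integral>\<^sup>+t. F (xi_pt \<iota> k (fst gh) (snd gh) t) \<partial>hk_meas k) < \<infinity>"
      unfolding R_def[symmetric] using m * [rule_format, of m] by auto
  qed
qed

end

section \<open>Comparison of weights with powers of \<open>u\<close>, and the threshold
  argument\<close>

lemma powr_bounds_below_1:
  fixes \<kappa> s e :: real
  assumes "0 < \<kappa>" "\<kappa> \<le> s" "s \<le> 1"
  shows "min 1 (\<kappa> powr e) \<le> s powr e" and "s powr e \<le> max 1 (\<kappa> powr e)"
proof -
  \<comment> \<open>The sign of \<open>e\<close> decides whether the power increases or decreases in
    the base; \<open>min\<close> and \<open>max\<close> cover both.\<close>
  consider "0 \<le> e" "\<kappa> powr e \<le> s powr e" "s powr e \<le> 1"
    | "e \<le> 0" "s powr e \<le> \<kappa> powr e" "1 \<le> s powr e"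
  proof (cases "0 \<le> e")
    case True
    then show ?thesis using assms that(1) by (auto simp: powr_mono2 powr_le1)
  next
    case False
    then have "1 \<le> s powr e" "s powr e \<le> \<kappa> powr e"
      using assms powr_mono2'[of e s 1] powr_mono2'[of e \<kappa> s] by auto
    then show ?thesis using False that(2) by auto
  qed
  then show "min 1 (\<kappa> powr e) \<le> s powr e" "s powr e \<le> max 1 (\<kappa> powr e)"
    by (cases; auto)+
qed

text \<open>The weight is \<open>tanh r powr a1 * cosh r powr (a1 + a2)\<close>, and
  \<open>cosh r \<ge> A\<close> keeps \<open>tanh r\<close> between \<open>\<kappa>\<close>, its
  value at \<open>cosh r = A\<close>, and 1. Away from the origin only \<open>a1 + a2\<close> is
  felt.\<close>

lemma weight_bounds:
  fixes A :: real
  assumes A: "1 < A"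
  shows "\<exists>m>0. \<forall>r\<ge>0. A \<le> cosh r \<longrightarrow> m * cosh r powr (a1 + a2) \<le> sinh r powr a1 * cosh r powr a2"
    and "\<exists>M\<ge>0. \<forall>r\<ge>0. A \<le> cosh r \<longrightarrow> sinh r powr a1 * cosh r powr a2 \<le> M * cosh r powr (a1 + a2)"
proof -
  define \<kappa> where "\<kappa> = sqrt (1 - 1 / A\<^sup>2)"
  have "1 / A\<^sup>2 < 1" using A by simp
  then have \<kappa>: "0 < \<kappa>" by (simp add: \<kappa>_def)
  have eq: "sinh r powr a1 * cosh r powr a2 = tanh r powr a1 * cosh r powr (a1 + a2)" for r :: real
    by (simp add: tanh_def powr_divide powr_add)
  have tanh: "\<kappa> \<le> tanh r \<and> tanh r \<le> 1" if "0 \<le> r" "A \<le> cosh r" for r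
  proof
    have "(tanh r)\<^sup>2 = 1 - 1 / (cosh r)\<^sup>2"
      by (simp add: tanh_def power_divide sinh_square_eq diff_divide_distrib)
    moreover have "1 / (cosh r)\<^sup>2 \<le> 1 / A\<^sup>2"
      using that A by (intro divide_left_mono power_mono) auto
    ultimately have "1 - 1 / A\<^sup>2 \<le> (tanh r)\<^sup>2" by simp
    then show "\<kappa> \<le> tanh r"
      unfolding \<kappa>_def using that by (intro real_le_lsqrt) auto
    show "tanh r \<le> 1" using tanh_real_lt_1[of r] by simp
  qed
  have "min 1 (\<kappa> powr a1) * cosh r powr (a1 + a2) \<le> sinh r powr a1 * cosh r powr a2"
    "sinh r powr a1 * cosh r powr a2 \<le> max 1 (\<kappa> powr a1) * cosh r powr (a1 + a2)"
    if "0 \<le> r" "A \<le> cosh r" for r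
    unfolding eq using tanh[OF that] \<kappa> by (auto intro!: mult_right_mono powr_bounds_below_1)
  moreover have "0 < min 1 (\<kappa> powr a1)" "0 \<le> max 1 (\<kappa> powr a1)"
    using \<kappa> by auto
  ultimately show "\<exists>m>0. \<forall>r\<ge>0. A \<le> cosh r \<longrightarrow> m * cosh r powr (a1 + a2) \<le> sinh r powr a1 * cosh r powr a2"
    "\<exists>M\<ge>0. \<forall>r\<ge>0. A \<le> cosh r \<longrightarrow> sinh r powr a1 * cosh r powr a2 \<le> M * cosh r powr (a1 + a2)"
    by blast+
qed

text \<open>A pointwise substitute for Hoelder's inequality: compare \<open>y\<close> with the threshold \<open>q\<close> to the power \<open>-\<beta>\<close>.\<close>
lemma le_powr_add_powr:
  fixes y q p \<beta> \<gamma> :: real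
  assumes y: "0 \<le> y" and q: "1 \<le> q" and p: "1 \<le> p" and \<gamma>: "\<beta> * (p - 1) \<le> \<gamma>"
  shows "y \<le> y powr p * q powr \<gamma> + q powr (- \<beta>)"
proof (cases "y \<le> q powr (- \<beta>)")
  case False
  then have y0: "0 < y" using q powr_gt_zero[of q "- \<beta>"] by linarith
  \<comment> \<open>Above the threshold this product is at least 1, so its power with exponent
    \<open>p - 1 \<ge> 0\<close> may be inserted as a factor.\<close>
  have "1 \<le> y * q powr \<beta>"
    using False q by (simp add: powr_minus field_simps)
  then have "1 \<le> (y * q powr \<beta>) powr (p - 1)"
    using p by (simp add: ge_one_powr_ge_zero)
  then have "y * 1 \<le> y * (y * q powr \<beta>) powr (p - 1)"
    using y by (intro mult_left_mono) auto
  also have "\<dots> = y powr p * q powr (\<beta> * (p - 1))"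
    using y0 q by (simp add: powr_mult powr_powr powr_diff right_diff_distrib)
  also have "\<dots> \<le> y powr p * q powr \<gamma>"
    using q \<gamma> by (intro mult_left_mono powr_mono) auto
  finally show ?thesis by (simp add: add_increasing2)
qed (simp add: add_increasing)

lemma nn_integral_powr_at_top:
  fixes A s :: real
  assumes "0 < A" "s < - 1"
  shows "(\<integral>\<^sup>+u. ennreal (u powr s) * indicator {A..} u \<partial>lborel) < \<infinity>"
  using nn_integral_has_integral_lebesgue'[OF _ has_integral_powr_to_inf[OF assms(2,1)]] by simp

lemma hyperbolic_density_le:
  assumes "2 \<le> n" "1 \<le> u"
  shows "(u\<^sup>2 - 1) powr ((real n - 2) / 2) \<le> u powr (real n - 2)"
proof -
  have "(u\<^sup>2 - 1) powr ((real n - 2) / 2) \<le> (u\<^sup>2) powr ((real n - 2) / 2)"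
    using assms by (intro powr_mono2) auto
  then show ?thesis using assms by (simp add: powr_half_power2)
qed

text \<open>In \<open>u\<close> the integrand is at most u^(s+n-2), integrable at infinity for
  exponents below -1. With s = k - n - \<beta> the condition becomes \<beta> > k - 1.\<close>

lemma nn_integral_hvol_powr_finite:
  fixes A s :: real
  assumes n: "2 \<le> CARD('n::finite)" and A: "1 \<le> A" and s: "s + real CARD('n) < 1"
  shows "(\<integral>\<^sup>+x. ennreal (ballcosh ((norm x)\<^sup>2) powr s) * indicator {A..} (ballcosh ((norm x)\<^sup>2)) \<partial>(hvol :: (real^'n) measure)) < \<infinity>"
proof -
  let ?n = "real CARD('n)"
  have "(\<integral>\<^sup>+u. ennreal (u powr s) * indicator {A..} u * ennreal ((u\<^sup>2 - 1) powr ((?n - 2) / 2)) * indicator {1..} u \<partial>lborel)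
      \<le> (\<integral>\<^sup>+u. ennreal (u powr (s + (?n - 2))) * indicator {A..} u \<partial>lborel)"
  proof (rule nn_integral_mono)
    fix u :: real
    show "ennreal (u powr s) * indicator {A..} u * ennreal ((u\<^sup>2 - 1) powr ((?n - 2) / 2)) * indicator {1..} u
        \<le> ennreal (u powr (s + (?n - 2))) * indicator {A..} u"
    proof (cases "A \<le> u")
      case True
      then have "u powr s * (u\<^sup>2 - 1) powr ((?n - 2) / 2) \<le> u powr s * u powr (?n - 2)"
        using A n by (intro mult_left_mono hyperbolic_density_le) auto
      then show ?thesis
        using True A by (simp add: powr_add ennreal_leI flip: ennreal_mult)
    qed simp
  qed
  also have "\<dots> < \<infinity>"
    using A s by (intro nn_integral_powr_at_top) auto
  finally show ?thesis
    by (subst nn_integral_hvol_radial[of "\<lambda>u. ennreal (u powr s) * indicator {A..} u"])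
       (auto simp: ennreal_mult_less_top)
qed

lemma AE_hvol: "AE x in (hvol :: (real^'n::finite) measure). norm x < 1"
proof -
  have [measurable]: "ball (0::real^'n) 1 \<in> sets borel" by simp
  show ?thesis
    unfolding hvol_def by (subst AE_density) (auto simp: indicator_def)
qed

text \<open>Take \<gamma> = a1 + a2 + n - k in \<open>le_powr_add_powr\<close> and multiply by
  u^(k-n). The first summand becomes |f|^p u^(a1+a2), bounded by the integrand of the norm up to a
  constant; the second is u^(k-n-\<beta>), integrable whatever \<open>f\<close> is.\<close>

lemma weighted_Lp_AE_Rk_finite:
  fixes \<iota> :: "nat \<Rightarrow> 'n::finite" and f :: "real^'n \<Rightarrow> real"
  assumes n: "2 \<le> CARD('n)" and k: "1 \<le> k" and \<iota>: "inj_on \<iota> {..k}" and haar: "haar_SO \<mu>"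
    and f: "f \<in> weighted_Lp p a1 a2" and p: "1 \<le> p"
    and \<beta>: "real k - 1 < \<beta>" "\<beta> * (p - 1) \<le> a1 + a2 + real CARD('n) - real k"
  shows "AE gh in Xi_meas \<mu> k. Rk_abs \<iota> k f (fst gh) (snd gh) < \<infinity>"
proof -
  let ?n = "real CARD('n)"
  have [measurable]: "f \<in> borel_measurable borel"
    using f by (simp add: weighted_Lp_def)
  let ?W = "\<lambda>x. \<bar>f x\<bar> powr p * sinh (hdist0 x) powr a1 * cosh (hdist0 x) powr a2"
  have Lp: "(\<integral>\<^sup>+x. ennreal (?W x) \<partial>hvol) < \<infinity>"
    using f by (simp add: weighted_Lp_def)
  have [measurable]: "(hdist0 :: real^'n \<Rightarrow> real) \<in> borel_measurable borel"
    unfolding hdist0_def[abs_def] by measurable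
  show ?thesis
    unfolding Rk_abs_def
  proof (rule AE_Rk_finite[OF n k \<iota> haar, of "\<lambda>x. ennreal \<bar>f x\<bar>"])
    fix A :: real assume A: "1 < A"
    obtain m where "0 < m"
      and m: "\<And>r. 0 \<le> r \<Longrightarrow> A \<le> cosh r \<Longrightarrow> m * cosh r powr (a1 + a2) \<le> sinh r powr a1 * cosh r powr a2"
      using weight_bounds(1)[OF A, of a1 a2] by blast
    let ?q = "\<lambda>x::real^'n. ballcosh ((norm x)\<^sup>2)"
    have "(\<integral>\<^sup>+x. ennreal \<bar>f x\<bar> * (ennreal (?q x powr (real k - ?n)) * indicator {A..} (?q x)) \<partial>hvol)
        \<le> (\<integral>\<^sup>+x. ennreal (1 / m) * ennreal (?W x) + ennreal (?q x powr (real k - ?n - \<beta>)) * indicator {A..} (?q x) \<partial>hvol)"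
    proof (rule nn_integral_mono_AE)
      have "ennreal \<bar>f x\<bar> * (ennreal (?q x powr (real k - ?n)) * indicator {A..} (?q x))
          \<le> ennreal (1 / m) * ennreal (?W x) + ennreal (?q x powr (real k - ?n - \<beta>)) * indicator {A..} (?q x)"
        if x: "norm x < 1" for x
      proof (cases "A \<le> ?q x")
        case True
        let ?u = "?q x"
        have u: "1 \<le> ?u" using True A by simp
        have "\<bar>f x\<bar> * ?u powr (real k - ?n)
            \<le> (\<bar>f x\<bar> powr p * ?u powr (a1 + a2 + ?n - real k) + ?u powr (- \<beta>)) * ?u powr (real k - ?n)"
          using u p \<beta> by (intro mult_right_mono le_powr_add_powr) auto
        also have "\<dots> = \<bar>f x\<bar> powr p * ?u powr (a1 + a2) + ?u powr (real k - ?n - \<beta>)"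
          by (simp add: ring_distribs mult.assoc flip: powr_add)
        also have "?u powr (a1 + a2) \<le> 1 / m * (sinh (hdist0 x) powr a1 * cosh (hdist0 x) powr a2)"
          using m[OF hdist0_nonneg[OF x]] True \<open>0 < m\<close>
          unfolding ballcosh_hdist0[OF x] by (simp add: field_simps)
        then have "\<bar>f x\<bar> powr p * ?u powr (a1 + a2) + ?u powr (real k - ?n - \<beta>) \<le> 1 / m * ?W x + ?u powr (real k - ?n - \<beta>)"
          using mult_left_mono[of "?u powr (a1 + a2)" "1 / m * (sinh (hdist0 x) powr a1 * cosh (hdist0 x) powr a2)" "\<bar>f x\<bar> powr p"]
          by (simp add: mult_ac)
        finally have "\<bar>f x\<bar> * ?u powr (real k - ?n) \<le> 1 / m * ?W x + ?u powr (real k - ?n - \<beta>)" .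
        then have "ennreal (\<bar>f x\<bar> * ?u powr (real k - ?n)) \<le> ennreal (1 / m * ?W x + ?u powr (real k - ?n - \<beta>))"
          by (rule ennreal_leI)
        also have "\<dots> = ennreal (1 / m) * ennreal (?W x) + ennreal (?u powr (real k - ?n - \<beta>))"
          using \<open>0 < m\<close> by (subst ennreal_plus) (auto simp flip: ennreal_mult)
        finally show ?thesis using True by (simp add: ennreal_mult)
      qed simp
      then show "AE x in hvol. ennreal \<bar>f x\<bar> * (ennreal (?q x powr (real k - ?n)) * indicator {A..} (?q x))
          \<le> ennreal (1 / m) * ennreal (?W x) + ennreal (?q x powr (real k - ?n - \<beta>)) * indicator {A..} (?q x)"
        using AE_hvol by (auto elim!: eventually_mono)
    qed
    also have "\<dots> = ennreal (1 / m) * (\<integral>\<^sup>+x. ennreal (?W x) \<partial>hvol) +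
        (\<integral>\<^sup>+x. ennreal (?q x powr (real k - ?n - \<beta>)) * indicator {A..} (?q x) \<partial>hvol)"
      by (subst nn_integral_add) (auto simp: nn_integral_cmult)
    also have "\<dots> < \<infinity>"
      using Lp nn_integral_hvol_powr_finite[OF n, of A "real k - ?n - \<beta>"] A \<beta>
      by (auto simp: ennreal_mult_less_top)
    finally show "(\<integral>\<^sup>+x. ennreal \<bar>f x\<bar> * (ennreal (?q x powr (real k - ?n)) * indicator {A..} (?q x)) \<partial>hvol) < \<infinity>" .
  qed measurable
qed

section \<open>The extremal radial function\<close>

text \<open>On a k-plane the density is of order u^(k-2), so the exponent -(k-1) leads to 1/(u ln
  u), which just fails to be integrable; in the norm the logarithm appears to the power -p, which
  for p > 1 restores convergence in the borderline case. The cutoff gives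
  \<open>ln u \<ge> 1\<close> and avoids the origin, where the weight may be singular.\<close>

definition critical_profile :: "nat \<Rightarrow> real \<Rightarrow> real" where
  "critical_profile k u = (if exp 1 \<le> u then u powr - (real k - 1) / ln u else 0)"

lemma critical_profile_measurable [measurable]: "critical_profile k \<in> borel_measurable borel"
  unfolding critical_profile_def[abs_def] by measurable

lemma critical_profile_nonneg: "0 \<le> critical_profile k u"
proof -
  have "0 \<le> ln u" if "exp 1 \<le> u"
    using that exp_gt_one[of 1] by (intro ln_ge_zero) linarith
  then show ?thesis by (simp add: critical_profile_def)
qed

lemma nn_integral_inverse_ln_powr_finite:
  fixes p :: real
  assumes "1 < p"
  shows "(\<integral>\<^sup>+u. ennreal (u powr - 1 * ln u powr - p) * indicator {exp 1..} u \<partial>lborel) < \<infinity>"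
proof -
  let ?F = "\<lambda>u. - (ln u powr (1 - p)) / (p - 1)"
  have "(\<integral>\<^sup>+u. ennreal (u powr - 1 * ln u powr - p) * indicator {exp 1..} u \<partial>lborel) = ennreal (0 - ?F (exp 1))"
  proof (rule nn_integral_FTC_atLeast)
    fix u :: real assume u: "exp 1 \<le> u"
    have u0: "0 < u" using u exp_gt_zero[of 1] by linarith
    have ln: "1 \<le> ln u" using u u0 by (simp add: ln_ge_iff)
    have u1: "1 < u" using u exp_gt_one[of 1] by linarith
    have cancel: "- ((1 - p) * x) / (p - 1) = x" for x
      using assms by (simp add: field_simps)
    have "(?F has_real_derivative - ((1 - p) * (ln u powr (1 - p - 1) * (1 / u))) / (p - 1)) (at u)"
      using u0 u1 ln assms by (auto intro!: derivative_eq_intros)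
    also have "- ((1 - p) * (ln u powr (1 - p - 1) * (1 / u))) / (p - 1) = u powr - 1 * ln u powr - p"
      unfolding cancel using u0 by (simp add: powr_minus_divide)
    finally show "(?F has_real_derivative u powr - 1 * ln u powr - p) (at u)" .
  next
    have "((\<lambda>u. ln u powr (1 - p)) \<longlongrightarrow> 0) at_top"
      using assms by (intro tendsto_neg_powr ln_at_top) auto
    from tendsto_divide[OF tendsto_minus[OF this] tendsto_const[of "p - 1"]]
    show "(?F \<longlongrightarrow> 0) at_top" using assms by simp
  qed auto
  then show ?thesis by simp
qed

text \<open>The antiderivative \<open>ln (ln (c * v))\<close> is unbounded. The constant
  \<open>c\<close> will be \<open>cosh h\<close> for a plane at distance \<open>h\<close>.\<close>

lemma nn_integral_inverse_ln_infinite: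
  fixes c :: real
  assumes "1 \<le> c"
  shows "(\<integral>\<^sup>+v. ennreal (1 / (v * ln (c * v))) * indicator {exp 1..} v \<partial>lborel) = \<infinity>"
proof (rule ccontr)
  let ?I = "(\<integral>\<^sup>+v. ennreal (1 / (v * ln (c * v))) * indicator {exp 1..} v \<partial>lborel)"
  assume "?I \<noteq> \<infinity>"
  then obtain I where I: "?I = ennreal I" "0 \<le> I"
    by (cases ?I) auto
  let ?F = "\<lambda>v. ln (ln (c * v))"
  have bound: "?F T - ?F (exp 1) \<le> I" if T: "exp 1 \<le> T" for T
  proof -
    have "ennreal (?F T - ?F (exp 1)) = (\<integral>\<^sup>+v. ennreal (1 / (v * ln (c * v))) * indicator {exp 1..T} v \<partial>lborel)"
    proof (rule nn_integral_FTC_Icc[symmetric])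
      fix v assume v: "v \<in> {exp 1..T}"
      then have v1: "1 < v" using less_le_trans[of 1 "exp 1" v] by simp
      moreover have "1 * v \<le> c * v" using assms v1 by (intro mult_right_mono) auto
      ultimately have cv: "1 < c * v" by linarith
      have "0 < ln (c * v)" using cv by simp
      then show "(?F has_real_derivative 1 / (v * ln (c * v))) (at v)"
        using v1 cv assms by (auto intro!: derivative_eq_intros simp: field_simps)
      show "0 \<le> 1 / (v * ln (c * v))" using v1 \<open>0 < ln (c * v)\<close> by simp
    qed (use T in auto)
    also have "\<dots> \<le> ?I"
      by (intro nn_integral_mono) (auto split: split_indicator)
    finally show ?thesis using I by (simp add: ennreal_le_iff)
  qed
  have "filterlim (\<lambda>T. ?F T - ?F (exp 1)) at_top at_top"
  proof -
    have "filterlim (\<lambda>T. c * T) at_top at_top"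
      using assms by (intro filterlim_tendsto_pos_mult_at_top[OF tendsto_const]) (auto simp: filterlim_ident)
    then have "filterlim ?F at_top at_top"
      by (intro filterlim_compose[OF ln_at_top])
    then show ?thesis
      using filterlim_tendsto_add_at_top[OF tendsto_const[of "- ?F (exp 1)"]] by simp
  qed
  then have "\<forall>\<^sub>F T in at_top. I < ?F T - ?F (exp 1)"
    by (simp add: filterlim_at_top_dense)
  then have "\<forall>\<^sub>F T in at_top. I < ?F T - ?F (exp 1) \<and> exp 1 \<le> T"
    using eventually_ge_at_top[of "exp 1"] by eventually_elim auto
  then obtain T where "I < ?F T - ?F (exp 1)" "exp 1 \<le> T"
    using eventually_happens'[OF trivial_limit_at_top_linorder] by blast
  with bound[of T] show False by linarith
qed

text \<open>Against weight and volume the p-th power is at most a constant times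
  \<open>u powr s * ln u powr - p\<close>, and \<open>le\<close> means \<open>s \<le> - 1\<close>.
  For \<open>p > 1\<close> the logarithm makes even \<open>s = - 1\<close> converge; for
  \<open>p = 1\<close> it does not, and \<open>strict\<close> gives \<open>s < - 1\<close>.\<close>

lemma critical_profile_weighted_Lp:
  fixes k :: nat and a1 a2 p :: real
  defines "f \<equiv> \<lambda>x::real^'n::finite. critical_profile k (ballcosh ((norm x)\<^sup>2))"
  assumes n: "2 \<le> CARD('n)" and p: "1 \<le> p"
    and le: "a1 + a2 + real CARD('n) - 1 \<le> p * (real k - 1)"
    and strict: "1 < p \<or> a1 + a2 + real CARD('n) - 1 < p * (real k - 1)"
  shows "f \<in> weighted_Lp p a1 a2"
proof -
  let ?n = "real CARD('n)"
  define s where "s = a1 + a2 + ?n - 2 - p * (real k - 1)"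
  have f_measurable [measurable]: "f \<in> borel_measurable borel" unfolding f_def by measurable
  have e: "1 < exp (1::real)" by simp
  obtain M where "0 \<le> M"
    and M: "\<And>r. 0 \<le> r \<Longrightarrow> exp 1 \<le> cosh r \<Longrightarrow> sinh r powr a1 * cosh r powr a2 \<le> M * cosh r powr (a1 + a2)"
    using weight_bounds(2)[OF e, of a1 a2] by blast
  define \<phi> where "\<phi> u = ennreal (critical_profile k u powr p * u powr (a1 + a2))" for u
  have [measurable]: "\<phi> \<in> borel_measurable borel" unfolding \<phi>_def by measurable
  have "(\<integral>\<^sup>+u. \<phi> u * ennreal ((u\<^sup>2 - 1) powr ((?n - 2) / 2)) * indicator {1..} u \<partial>lborel)
      \<le> (\<integral>\<^sup>+u. ennreal (u powr s * ln u powr - p) * indicator {exp 1..} u \<partial>lborel)"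
  proof (rule nn_integral_mono)
    fix u :: real
    show "\<phi> u * ennreal ((u\<^sup>2 - 1) powr ((?n - 2) / 2)) * indicator {1..} u
        \<le> ennreal (u powr s * ln u powr - p) * indicator {exp 1..} u"
    proof (cases "exp 1 \<le> u")
      case True
      then have u: "1 < u" using e by linarith
      have "critical_profile k u powr p = (u powr - (real k - 1)) powr p / ln u powr p"
        using True by (simp add: critical_profile_def powr_divide)
      also have "(u powr - (real k - 1)) powr p = u powr - (p * (real k - 1))"
        unfolding powr_powr by (simp only: mult_minus_left mult_minus_right mult.commute)
      finally have cp: "critical_profile k u powr p = u powr - (p * (real k - 1)) * ln u powr - p"
        by (simp only: powr_minus[of "ln u"] divide_inverse)
      have "critical_profile k u powr p * u powr (a1 + a2) * (u\<^sup>2 - 1) powr ((?n - 2) / 2)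
          \<le> critical_profile k u powr p * u powr (a1 + a2) * u powr (?n - 2)"
        using u n by (intro mult_left_mono hyperbolic_density_le) auto
      also have "\<dots> = u powr s * ln u powr - p"
        unfolding cp by (simp add: s_def powr_add powr_diff powr_minus_divide field_simps)
      finally have "ennreal (critical_profile k u powr p * u powr (a1 + a2) * (u\<^sup>2 - 1) powr ((?n - 2) / 2))
          \<le> ennreal (u powr s * ln u powr - p)"
        by (rule ennreal_leI)
      then show ?thesis using True u by (simp add: \<phi>_def flip: ennreal_mult)
    qed (simp add: \<phi>_def critical_profile_def)
  qed
  also have "\<dots> < \<infinity>"
  proof (cases "1 < p")
    case True
    have "(\<integral>\<^sup>+u. ennreal (u powr s * ln u powr - p) * indicator {exp 1..} u \<partial>lborel)
        \<le> (\<integral>\<^sup>+u. ennreal (u powr - 1 * ln u powr - p) * indicator {exp 1..} u \<partial>lborel)"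
    proof (rule nn_integral_mono)
      fix u :: real
      have "u powr s * ln u powr - p \<le> u powr - 1 * ln u powr - p" if "exp 1 \<le> u"
      proof -
        have "1 \<le> u" using that e by linarith
        then show ?thesis using le by (intro mult_right_mono powr_mono) (auto simp: s_def)
      qed
      then show "ennreal (u powr s * ln u powr - p) * indicator {exp 1..} u
          \<le> ennreal (u powr - 1 * ln u powr - p) * indicator {exp 1..} u"
        by (auto split: split_indicator intro: ennreal_leI)
    qed
    then show ?thesis using nn_integral_inverse_ln_powr_finite[OF True] by (rule le_less_trans)
  next
    case False
    then have s: "s < - 1" using strict by (simp add: s_def)
    have "(\<integral>\<^sup>+u. ennreal (u powr s * ln u powr - p) * indicator {exp 1..} u \<partial>lborel)
        \<le> (\<integral>\<^sup>+u. ennreal (u powr s) * indicator {exp 1..} u \<partial>lborel)"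
    proof (rule nn_integral_mono)
      fix u :: real
      have "u powr s * ln u powr - p \<le> u powr s" if "exp 1 \<le> u"
      proof -
        have "0 < u" using that e by linarith
        then have "1 \<le> ln u" using that by (simp add: ln_ge_iff)
        then have "ln u powr - p \<le> ln u powr 0" using p by (intro powr_mono) auto
        then show ?thesis using \<open>1 \<le> ln u\<close> by (intro mult_left_le) auto
      qed
      then show "ennreal (u powr s * ln u powr - p) * indicator {exp 1..} u
          \<le> ennreal (u powr s) * indicator {exp 1..} u"
        by (auto split: split_indicator intro: ennreal_leI)
    qed
    then show ?thesis using nn_integral_powr_at_top[OF exp_gt_zero s] by (rule le_less_trans)
  qed
  finally have "(\<integral>\<^sup>+x. \<phi> (ballcosh ((norm x)\<^sup>2)) \<partial>(hvol :: (real^'n) measure)) < \<infinity>"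
    by (subst nn_integral_hvol_radial) (auto simp: ennreal_mult_less_top)
  then have fin: "(\<integral>\<^sup>+x. ennreal M * \<phi> (ballcosh ((norm x)\<^sup>2)) \<partial>(hvol :: (real^'n) measure)) < \<infinity>"
    by (subst nn_integral_cmult) (auto simp: ennreal_mult_less_top)
  have "(\<integral>\<^sup>+x. ennreal (\<bar>f x\<bar> powr p * sinh (hdist0 x) powr a1 * cosh (hdist0 x) powr a2) \<partial>hvol)
      \<le> (\<integral>\<^sup>+x. ennreal M * \<phi> (ballcosh ((norm x)\<^sup>2)) \<partial>(hvol :: (real^'n) measure))"
  proof (rule nn_integral_mono_AE)
    have "ennreal (\<bar>f x\<bar> powr p * sinh (hdist0 x) powr a1 * cosh (hdist0 x) powr a2)
        \<le> ennreal M * \<phi> (ballcosh ((norm x)\<^sup>2))" if x: "norm x < 1" for x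
    proof (cases "exp 1 \<le> ballcosh ((norm x)\<^sup>2)")
      case True
      then have "sinh (hdist0 x) powr a1 * cosh (hdist0 x) powr a2 \<le> M * ballcosh ((norm x)\<^sup>2) powr (a1 + a2)"
        using M[OF hdist0_nonneg[OF x]] unfolding ballcosh_hdist0[OF x] by simp
      then have "\<bar>f x\<bar> powr p * (sinh (hdist0 x) powr a1 * cosh (hdist0 x) powr a2)
          \<le> \<bar>f x\<bar> powr p * (M * ballcosh ((norm x)\<^sup>2) powr (a1 + a2))"
        by (rule mult_left_mono) simp
      then show ?thesis
        using \<open>0 \<le> M\<close> unfolding \<phi>_def f_def
        by (simp add: critical_profile_nonneg mult_ac ennreal_leI flip: ennreal_mult)
    qed (simp add: f_def critical_profile_def)
    then show "AE x in hvol. ennreal (\<bar>f x\<bar> powr p * sinh (hdist0 x) powr a1 * cosh (hdist0 x) powr a2)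
        \<le> ennreal M * \<phi> (ballcosh ((norm x)\<^sup>2))"
      using AE_hvol by (auto elim!: eventually_mono)
  qed
  also note fin
  finally show ?thesis by (simp add: weighted_Lp_def)
qed

text \<open>For \<open>v \<ge> exp 1\<close> the point \<open>c * v\<close> lies beyond the cutoff
  and the density is at least a constant times v^(k-2). The integrand is then at least m / (v ln(c
  v)), whose integral diverges for every \<open>h\<close>.\<close>

lemma Rk_critical_profile_infinite:
  fixes \<iota> :: "nat \<Rightarrow> 'n::finite"
  assumes k: "1 \<le> k" and \<iota>: "inj_on \<iota> {..k}" and g: "g \<in> SOn"
  shows "Rk_nn \<iota> k (\<lambda>x. critical_profile k (ballcosh ((norm x)\<^sup>2))) g h = \<infinity>"
proof -
  define c where "c = cosh h"
  have c: "1 \<le> c" by (simp add: c_def cosh_real_ge_1)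
  \<comment> \<open>The power of \<open>c\<close> is split off from that of \<open>c * v\<close>.
    The minimum bounds the power of (v^2 - 1)/v^2, a number between 1/2 and 1, for either sign of
    the exponent.\<close>
  define m where "m = min 1 ((1 / 2) powr ((real k - 2) / 2)) * c powr - (real k - 1)"
  have m: "0 < m" using c by (simp add: m_def)
  have "0 < unit_ball_vol (real k)" by simp
  then have vol: "unit_ball_vol (real k) \<noteq> 0" by (rule less_imp_neq[symmetric])
  have "Rk_nn \<iota> k (\<lambda>x. critical_profile k (ballcosh ((norm x)\<^sup>2))) g h =
      (\<integral>\<^sup>+t. ennreal (critical_profile k (c * ballcosh (\<Sum>i<k. (t i)\<^sup>2))) \<partial>hk_meas k)"
    by (simp add: Rk_nn_def ballcosh_xi_pt[OF \<iota> g] c_def)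
  also have "\<dots> = ennreal (k * unit_ball_vol k) *
      (\<integral>\<^sup>+v. ennreal (critical_profile k (c * v)) * ennreal ((v\<^sup>2 - 1) powr ((real k - 2) / 2)) * indicator {1..} v \<partial>lborel)"
    by (rule nn_integral_hk_meas_radial[of "\<lambda>v. ennreal (critical_profile k (c * v))"]) (use k in auto)
  also have "(\<integral>\<^sup>+v. ennreal (critical_profile k (c * v)) * ennreal ((v\<^sup>2 - 1) powr ((real k - 2) / 2)) * indicator {1..} v \<partial>lborel) = \<infinity>"
  proof -
    have "\<infinity> = ennreal m * (\<integral>\<^sup>+v. ennreal (1 / (v * ln (c * v))) * indicator {exp 1..} v \<partial>lborel)"
      using m by (simp add: nn_integral_inverse_ln_infinite[OF c] ennreal_mult_top)
    also have "\<dots> = (\<integral>\<^sup>+v. ennreal m * (ennreal (1 / (v * ln (c * v))) * indicator {exp 1..} v) \<partial>lborel)"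
      by (rule nn_integral_cmult[symmetric]) measurable
    also have "\<dots> \<le> (\<integral>\<^sup>+v. ennreal (critical_profile k (c * v)) * ennreal ((v\<^sup>2 - 1) powr ((real k - 2) / 2)) * indicator {1..} v \<partial>lborel)"
    proof (rule nn_integral_mono)
      fix v :: real
      show "ennreal m * (ennreal (1 / (v * ln (c * v))) * indicator {exp 1..} v)
          \<le> ennreal (critical_profile k (c * v)) * ennreal ((v\<^sup>2 - 1) powr ((real k - 2) / 2)) * indicator {1..} v"
      proof (cases "exp 1 \<le> v")
        case True
        have "2 \<le> exp (1::real)" using exp_ge_add_one_self[of 1] by simp
        then have v: "2 \<le> v" using True by linarith
        have cv: "v \<le> c * v" using c v by simp
        have ln: "0 < ln (c * v)" using cv v by (intro ln_gt_zero) linarith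
        have "4 \<le> v\<^sup>2" using power_mono[OF v, of 2] by simp
        moreover have "0 < v\<^sup>2" using v by simp
        ultimately have "1 / 2 \<le> (v\<^sup>2 - 1) / v\<^sup>2" "(v\<^sup>2 - 1) / v\<^sup>2 \<le> 1" by (auto simp: field_simps)
        then have "min 1 ((1 / 2) powr ((real k - 2) / 2)) \<le> ((v\<^sup>2 - 1) / v\<^sup>2) powr ((real k - 2) / 2)"
          by (intro powr_bounds_below_1) auto
        also have "\<dots> = (v\<^sup>2 - 1) powr ((real k - 2) / 2) / v powr (real k - 2)"
          using v by (simp add: powr_divide powr_half_power2)
        finally have low: "min 1 ((1 / 2) powr ((real k - 2) / 2)) * v powr (real k - 2) \<le> (v\<^sup>2 - 1) powr ((real k - 2) / 2)"
          using v by (simp add: field_simps)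
        have "m * (1 / (v * ln (c * v))) = (c * v) powr - (real k - 1) / ln (c * v) *
            (min 1 ((1 / 2) powr ((real k - 2) / 2)) * v powr (real k - 2))"
        proof -
          have "v powr - (real k - 1) * v powr (real k - 2) = 1 / v"
            using v by (simp add: powr_minus_divide flip: powr_add)
          then have "m * (1 / (v * ln (c * v))) = m * (v powr - (real k - 1) * v powr (real k - 2)) / ln (c * v)"
            by simp
          then show ?thesis
            by (simp add: m_def powr_mult mult_ac)
        qed
        also have "\<dots> \<le> (c * v) powr - (real k - 1) / ln (c * v) * (v\<^sup>2 - 1) powr ((real k - 2) / 2)"
          using low ln by (intro mult_left_mono) auto
        also have "(c * v) powr - (real k - 1) / ln (c * v) = critical_profile k (c * v)"
          using True cv by (simp add: critical_profile_def)
        finally have "ennreal (m * (1 / (v * ln (c * v)))) \<le> ennreal (critical_profile k (c * v) * (v\<^sup>2 - 1) powr ((real k - 2) / 2))"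
          by (rule ennreal_leI)
        also have "ennreal (m * (1 / (v * ln (c * v)))) = ennreal m * ennreal (1 / (v * ln (c * v)))"
          using m v ln by (intro ennreal_mult) auto
        finally show ?thesis
          using True v critical_profile_nonneg[of k "c * v"] by (simp add: ennreal_mult)
      qed simp
    qed
    finally show ?thesis by (simp add: top_unique)
  qed
  finally show ?thesis
    using k vol by (simp add: ennreal_mult_top)
qed

theorem theorem3p1:
  fixes \<iota> :: "nat \<Rightarrow> 'n::finite" and k :: nat and \<alpha>1 \<alpha>2 p :: real
  assumes "2 \<le> CARD('n)" and "1 \<le> k" and "k \<le> CARD('n) - 1"
    and "bij_betw \<iota> {..<CARD('n)} UNIV" and "1 \<le> p"
  shows "((\<alpha>1 + \<alpha>2 > real k - real CARD('n) \<and>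
             (k = 1 \<or> p < (\<alpha>1 + \<alpha>2 + real CARD('n) - 1) / (real k - 1))) \<or>
          (\<alpha>1 + \<alpha>2 = real k - real CARD('n) \<and> p = 1)
         \<longrightarrow> (\<forall>f \<in> (weighted_Lp p \<alpha>1 \<alpha>2 :: (real^'n \<Rightarrow> real) set). \<forall>\<mu>. haar_SO \<mu> \<longrightarrow>
               (AE gh in Xi_meas \<mu> k. Rk_abs \<iota> k f (fst gh) (snd gh) < \<infinity>)))
       \<and> (\<not> ((\<alpha>1 + \<alpha>2 > real k - real CARD('n) \<and>
             (k = 1 \<or> p < (\<alpha>1 + \<alpha>2 + real CARD('n) - 1) / (real k - 1))) \<or>
          (\<alpha>1 + \<alpha>2 = real k - real CARD('n) \<and> p = 1))
         \<longrightarrow> (\<exists>f \<in> (weighted_Lp p \<alpha>1 \<alpha>2 :: (real^'n \<Rightarrow> real) set).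
               (\<forall>x. 0 \<le> f x) \<and> radial f \<and>
               (\<forall>g\<in>SOn. \<forall>h\<ge>0. Rk_nn \<iota> k f g h = \<infinity>)))"
    (is "(?C \<longrightarrow> ?P) \<and> (\<not> ?C \<longrightarrow> ?Q)")
proof -
  let ?n = "real CARD('n)"
  have "k < CARD('n)" using assms(1,3) by linarith
  then have \<iota>: "inj_on \<iota> {..k}"
    using bij_betw_imp_inj_on[OF assms(4)] by (rule_tac inj_on_subset) auto
  show ?thesis
  proof (intro conjI impI)
    assume C: ?C
    \<comment> \<open>For \<open>p = 1\<close> the second condition is free of
      \<open>\<beta>\<close>, and \<open>\<beta> = k\<close> serves. For \<open>p > 1\<close> the
      largest admissible value is chosen; by (i) it exceeds \<open>k - 1\<close>.\<close>
    have "\<exists>\<beta>. real k - 1 < \<beta> \<and> \<beta> * (p - 1) \<le> \<alpha>1 + \<alpha>2 + ?n - real k"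
    proof (cases "p = 1")
      case True
      then show ?thesis using C by (intro exI[of _ "real k"]) auto
    next
      case False
      then have p: "0 < p - 1" using assms(5) by simp
      have "(real k - 1) * (p - 1) < \<alpha>1 + \<alpha>2 + ?n - real k"
      proof (cases "k = 1")
        case True
        then show ?thesis using C False by auto
      next
        case k: False
        then have "0 < real k - 1" using assms(2) by simp
        moreover have "p < (\<alpha>1 + \<alpha>2 + ?n - 1) / (real k - 1)" using C False k by auto
        ultimately have "p * (real k - 1) < \<alpha>1 + \<alpha>2 + ?n - 1" by (simp add: pos_less_divide_eq)
        then show ?thesis by (simp add: algebra_simps)
      qed
      then show ?thesis
        using p by (intro exI[of _ "(\<alpha>1 + \<alpha>2 + ?n - real k) / (p - 1)"]) (simp add: pos_less_divide_eq)
    qed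
    then show ?P
      using weighted_Lp_AE_Rk_finite[OF assms(1,2) \<iota> _ _ assms(5)] by blast
  next
    assume nC: "\<not> ?C"
    have le: "\<alpha>1 + \<alpha>2 + ?n - 1 \<le> p * (real k - 1)"
      and strict: "1 < p \<or> \<alpha>1 + \<alpha>2 + ?n - 1 < p * (real k - 1)"
    proof -
      have pk: "real k - 1 \<le> p * (real k - 1)"
        using assms(2,5) mult_right_mono[of 1 p "real k - 1"] by simp
      \<comment> \<open>In the first two cases \<open>pk\<close> gives the inequality. In the third
        \<open>k > 1\<close> makes the quotient genuine, and \<open>p = 1\<close> would contradict
        \<alpha>1 + \<alpha>2 > k - n.\<close>
      consider "\<alpha>1 + \<alpha>2 < real k - ?n" | "\<alpha>1 + \<alpha>2 = real k - ?n" "p \<noteq> 1"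
        | "\<alpha>1 + \<alpha>2 > real k - ?n" "k \<noteq> 1" "\<not> p < (\<alpha>1 + \<alpha>2 + ?n - 1) / (real k - 1)"
        using nC by (cases "\<alpha>1 + \<alpha>2" "real k - ?n" rule: linorder_cases) auto
      then have "\<alpha>1 + \<alpha>2 + ?n - 1 \<le> p * (real k - 1) \<and> (1 < p \<or> \<alpha>1 + \<alpha>2 + ?n - 1 < p * (real k - 1))"
      proof cases
        case 3
        then have "0 < real k - 1" using assms(2) by simp
        then have "\<alpha>1 + \<alpha>2 + ?n - 1 \<le> p * (real k - 1)"
          using 3(3) by (simp add: not_less pos_divide_le_eq)
        moreover have "p \<noteq> 1" using calculation 3(1) by auto
        ultimately show ?thesis using assms(5) by auto
      qed (use pk assms(5) in auto)
      then show "\<alpha>1 + \<alpha>2 + ?n - 1 \<le> p * (real k - 1)" "1 < p \<or> \<alpha>1 + \<alpha>2 + ?n - 1 < p * (real k - 1)"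
        by auto
    qed
    let ?f = "\<lambda>x::real^'n. critical_profile k (ballcosh ((norm x)\<^sup>2))"
    have "radial ?f"
      unfolding radial_def
      by (intro exI[of _ "\<lambda>r. critical_profile k (cosh r)"]) (auto simp: ballcosh_hdist0)
    then show ?Q
      using critical_profile_weighted_Lp[OF assms(1,5) le strict]
        critical_profile_nonneg Rk_critical_profile_infinite[OF assms(2) \<iota>]
      by (intro bexI[of _ ?f]) auto
  qed
qed

end
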